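(* Let $n\ge 2$, let $\mathfrak{T}$ be a triangular $n$-matrix ring and let $\mathfrak{S}$ be any ring. Let $\varphi:\mathfrak{T}\to\mathfrak{S}$ be a bijective Lie $n$-multiplicative mapping satisfying $\varphi(\mathcal{Z}(\mathfrak{T}))\subset\mathcal{Z}(\mathfrak{S})$. Then for all $A,B\in\mathfrak{T}$ there is an element $S_{A,B}\in\mathcal{Z}(\mathfrak{S})$, depending on $A$ and $B$, such that $$\varphi(A+B)=\varphi(A)+\varphi(B)+S_{A,B}.$$
   Context: Rings are associative and not assumed to be unital; modules are not assumed to be unitary. $\mathcal{Z}(\mathfrak{R})$ denotes the centre of a ring $\mathfrak{R}$. Lie $n$-multiplicative mapping: put $[x_1,x_2]=x_1x_2-x_2x_1$, $p_1(x)=x$ and $p_n(x_1,\ldots,x_n)=[p_{n-1}(x_1,\ldots,x_{n-1}),x_n]$ for $n\ge 2$. For $n\ge2$, a (not necessarily additive) map $\varphi:\mathfrak{R}\to\mathfrak{S}$ between rings is Lie $n$-multiplicative if $\varphi(p_n(x_1,\ldots,x_n))=p_n(\varphi(x_1),\ldots,\varphi(x_n))$ for all $x_1,\ldots,x_n\in\mathfrak{R}$. Triangular $n$-matrix ring: let $\mathfrak{R}_1,\ldots,\mathfrak{R}_n$ be rings and, for $1\le i\le j\le n$, let $\mathfrak{M}_{ij}$ be an $(\mathfrak{R}_i,\mathfrak{R}_j)$-bimodule, with $\mathfrak{M}_{ii}=\mathfrak{R}_i$. For $1\le i\le j\le k\le n$ let $\mu_{ijk}:\mathfrak{M}_{ij}\otimes_{\mathfrak{R}_j}\mathfrak{M}_{jk}\to\mathfrak{M}_{ik}$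 be $(\mathfrak{R}_i,\mathfrak{R}_k)$-bimodule homomorphisms, where $\mu_{iij}$ and $\mu_{ijj}$ are the canonical multiplication maps, and write $ab=\mu_{ijk}(a\otimes b)$. Assume: (i) for $i<j$, $\mathfrak{M}_{ij}$ is faithful as a left $\mathfrak{R}_i$-module and faithful as a right $\mathfrak{R}_j$-module; (ii) for $i<j$, if $m_{ij}\in\mathfrak{M}_{ij}$ satisfies $\mathfrak{R}_i m_{ij}\mathfrak{R}_j=0$, then $m_{ij}=0$. Let $\mathfrak{T}$ be the set of all upper triangular $n\times n$ matrices with $(i,j)$-entry in $\mathfrak{M}_{ij}$ for $1\le i\le j\le n$, with the obvious matrix addition and multiplication. If $a(bc)=(ab)c$ for all $a\in\mathfrak{M}_{ik}$, $b\in\mathfrak{M}_{kl}$, $c\in\mathfrak{M}_{lj}$, $1\le i\le k\le l\le j\le n$ (equivalently, $\mathfrak{T}$ is a ring), then $\mathfrak{T}$ is called a triangular $n$-matrix ring. The integer $n$ in "triangular $n$-matrix ring" and in "Lie $n$-multiplicative" is the same. *)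

theory Defs
  imports "HOL-Algebra.Ring"
begin

text \<open>
  Rings are associative and need not be unital. They are represented by the ring records of
  HOL-Algebra; the field \<open>one\<close> of these records is never constrained and never used.
\<close>

locale rng = abelian_group R for R (structure) +
  assumes m_closed: "\<lbrakk>x \<in> carrier R; y \<in> carrier R\<rbrakk> \<Longrightarrow> x \<otimes> y \<in> carrier R"
    and m_assoc: "\<lbrakk>x \<in> carrier R; y \<in> carrier R; z \<in> carrier R\<rbrakk>
      \<Longrightarrow> (x \<otimes> y) \<otimes> z = x \<otimes> (y \<otimes> z)"
    and l_distr: "\<lbrakk>x \<in> carrier R; y \<in> carrier R; z \<in> carrier R\<rbrakk>
      \<Longrightarrow> (x \<oplus> y) \<otimes> z = x \<otimes> z \<oplus> y \<otimes> z"
    and r_distr: "\<lbrakk>x \<in> carrier R; y \<in> carrier R; z \<in> carrier R\<rbrakk>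
      \<Longrightarrow> z \<otimes> (x \<oplus> y) = z \<otimes> x \<oplus> z \<otimes> y"

definition ring_center :: "('a, 'x) ring_scheme \<Rightarrow> 'a set" where
  "ring_center R = {z \<in> carrier R. \<forall>x\<in>carrier R. z \<otimes>\<^bsub>R\<^esub> x = x \<otimes>\<^bsub>R\<^esub> z}"

definition lie_bracket :: "('a, 'x) ring_scheme \<Rightarrow> 'a \<Rightarrow> 'a \<Rightarrow> 'a" where
  "lie_bracket R x y = x \<otimes>\<^bsub>R\<^esub> y \<ominus>\<^bsub>R\<^esub> y \<otimes>\<^bsub>R\<^esub> x"

text \<open>
  \<open>lie_p R n x\<close> is $p_n(x_1,\ldots,x_n)$ with \<open>x i\<close> for $x_i$; only the values of \<open>x\<close> at
  $1,\ldots,n$ matter, and the case \<open>n = 0\<close> is meaningless.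
\<close>

fun lie_p :: "('a, 'x) ring_scheme \<Rightarrow> nat \<Rightarrow> (nat \<Rightarrow> 'a) \<Rightarrow> 'a" where
  "lie_p R 0 x = undefined"
| "lie_p R (Suc 0) x = x 1"
| "lie_p R (Suc (Suc m)) x = lie_bracket R (lie_p R (Suc m) x) (x (Suc (Suc m)))"

definition lie_multiplicative ::
    "nat \<Rightarrow> ('a, 'x) ring_scheme \<Rightarrow> ('b, 'y) ring_scheme \<Rightarrow> ('a \<Rightarrow> 'b) \<Rightarrow> bool" where
  "lie_multiplicative n R S \<phi> \<longleftrightarrow>
     \<phi> \<in> carrier R \<rightarrow> carrier S \<and>
     (\<forall>x \<in> {1..n} \<rightarrow> carrier R. \<phi> (lie_p R n x) = lie_p S n (\<lambda>i. \<phi> (x i)))"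

text \<open>
  As for the module records of HOL-Algebra, only the additive part of the underlying ring record
  is used. Bimodules need not be unitary.
\<close>

record ('r, 's, 'm) bimodule = "'m ring" +
  lact :: "'r \<Rightarrow> 'm \<Rightarrow> 'm"
  ract :: "'m \<Rightarrow> 's \<Rightarrow> 'm"

locale bimodule = R: rng R + S: rng S + M: abelian_group M
  for R :: "('r, 'x) ring_scheme" and S :: "('s, 'y) ring_scheme"
    and M :: "('r, 's, 'm, 'z) bimodule_scheme" +
  assumes lact_closed: "\<lbrakk>r \<in> carrier R; m \<in> carrier M\<rbrakk> \<Longrightarrow> lact M r m \<in> carrier M"
    and ract_closed: "\<lbrakk>m \<in> carrier M; s \<in> carrier S\<rbrakk> \<Longrightarrow> ract M m s \<in> carrier M"
    and lact_add_left: "\<lbrakk>r \<in> carrier R; r' \<in> carrier R; m \<in> carrier M\<rbrakk>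
      \<Longrightarrow> lact M (r \<oplus>\<^bsub>R\<^esub> r') m = lact M r m \<oplus>\<^bsub>M\<^esub> lact M r' m"
    and lact_add_right: "\<lbrakk>r \<in> carrier R; m \<in> carrier M; m' \<in> carrier M\<rbrakk>
      \<Longrightarrow> lact M r (m \<oplus>\<^bsub>M\<^esub> m') = lact M r m \<oplus>\<^bsub>M\<^esub> lact M r m'"
    and lact_assoc: "\<lbrakk>r \<in> carrier R; r' \<in> carrier R; m \<in> carrier M\<rbrakk>
      \<Longrightarrow> lact M (r \<otimes>\<^bsub>R\<^esub> r') m = lact M r (lact M r' m)"
    and ract_add_left: "\<lbrakk>m \<in> carrier M; m' \<in> carrier M; s \<in> carrier S\<rbrakk>
      \<Longrightarrow> ract M (m \<oplus>\<^bsub>M\<^esub> m') s = ract M m s \<oplus>\<^bsub>M\<^esub> ract M m' s"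
    and ract_add_right: "\<lbrakk>m \<in> carrier M; s \<in> carrier S; s' \<in> carrier S\<rbrakk>
      \<Longrightarrow> ract M m (s \<oplus>\<^bsub>S\<^esub> s') = ract M m s \<oplus>\<^bsub>M\<^esub> ract M m s'"
    and ract_assoc: "\<lbrakk>m \<in> carrier M; s \<in> carrier S; s' \<in> carrier S\<rbrakk>
      \<Longrightarrow> ract M m (s \<otimes>\<^bsub>S\<^esub> s') = ract M (ract M m s) s'"
    and lact_ract: "\<lbrakk>r \<in> carrier R; m \<in> carrier M; s \<in> carrier S\<rbrakk>
      \<Longrightarrow> ract M (lact M r m) s = lact M r (ract M m s)"

definition regular_bimodule :: "'a ring \<Rightarrow> ('a, 'a, 'a) bimodule" where
  "regular_bimodule R = ring.extend R (bimodule.fields (mult R) (mult R))"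

definition faithful_left :: "('r, 'x) ring_scheme \<Rightarrow> ('r, 's, 'm, 'z) bimodule_scheme \<Rightarrow> bool" where
  "faithful_left R M \<longleftrightarrow> (\<forall>r\<in>carrier R. (\<forall>m\<in>carrier M. lact M r m = \<zero>\<^bsub>M\<^esub>) \<longrightarrow> r = \<zero>\<^bsub>R\<^esub>)"

definition faithful_right :: "('s, 'y) ring_scheme \<Rightarrow> ('r, 's, 'm, 'z) bimodule_scheme \<Rightarrow> bool" where
  "faithful_right S M \<longleftrightarrow> (\<forall>s\<in>carrier S. (\<forall>m\<in>carrier M. ract M m s = \<zero>\<^bsub>M\<^esub>) \<longrightarrow> s = \<zero>\<^bsub>S\<^esub>)"

text \<open>
  An $(R,Q)$-bimodule homomorphism $M \otimes_S N \to P$, where \<open>M\<close> is an $(R,S)$-bimodule,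
  \<open>N\<close> an $(S,Q)$-bimodule and \<open>P\<close> an $(R,Q)$-bimodule, is given by its values
  \<open>\<mu> a b\<close> on the pure tensors $a \otimes b$: by the universal property of $\otimes_S$ these are
  exactly the biadditive, \<open>S\<close>-balanced maps compatible with the outer actions.
\<close>

locale tensor_bimodule_hom =
  MRS: bimodule R S M + NSQ: bimodule S Q N + PRQ: bimodule R Q P
  for R :: "('r, 'x) ring_scheme" and S :: "('s, 'y) ring_scheme" and Q :: "('q, 'w) ring_scheme"
    and M :: "('r, 's, 'm, 'u) bimodule_scheme" and N :: "('s, 'q, 'k, 'v) bimodule_scheme"
    and P :: "('r, 'q, 'p, 'z) bimodule_scheme" +
  fixes \<mu> :: "'m \<Rightarrow> 'k \<Rightarrow> 'p"
  assumes hom_closed: "\<lbrakk>a \<in> carrier M; b \<in> carrier N\<rbrakk> \<Longrightarrow> \<mu> a b \<in> carrier P"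
    and hom_add_left: "\<lbrakk>a \<in> carrier M; a' \<in> carrier M; b \<in> carrier N\<rbrakk>
      \<Longrightarrow> \<mu> (a \<oplus>\<^bsub>M\<^esub> a') b = \<mu> a b \<oplus>\<^bsub>P\<^esub> \<mu> a' b"
    and hom_add_right: "\<lbrakk>a \<in> carrier M; b \<in> carrier N; b' \<in> carrier N\<rbrakk>
      \<Longrightarrow> \<mu> a (b \<oplus>\<^bsub>N\<^esub> b') = \<mu> a b \<oplus>\<^bsub>P\<^esub> \<mu> a b'"
    and hom_balanced: "\<lbrakk>a \<in> carrier M; s \<in> carrier S; b \<in> carrier N\<rbrakk>
      \<Longrightarrow> \<mu> (ract M a s) b = \<mu> a (lact N s b)"
    and hom_lact: "\<lbrakk>r \<in> carrier R; a \<in> carrier M; b \<in> carrier N\<rbrakk>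
      \<Longrightarrow> \<mu> (lact M r a) b = lact P r (\<mu> a b)"
    and hom_ract: "\<lbrakk>a \<in> carrier M; b \<in> carrier N; q \<in> carrier Q\<rbrakk>
      \<Longrightarrow> \<mu> a (ract N b q) = ract P (\<mu> a b) q"

text \<open>
  The rings $R_i$ and the bimodules $M_{ij}$ have arbitrary, unrelated carriers inside a common
  type, which is no restriction since one may pass to a disjoint union. The product
  $ab = \mu_{ijk}(a \otimes b)$ is \<open>\<mu> i j k a b\<close>.
\<close>

locale triangular_matrix_ring =
  fixes n :: nat
    and R :: "nat \<Rightarrow> 'a ring"
    and M :: "nat \<Rightarrow> nat \<Rightarrow> ('a, 'a, 'a) bimodule"
    and \<mu> :: "nat \<Rightarrow> nat \<Rightarrow> nat \<Rightarrow> 'a \<Rightarrow> 'a \<Rightarrow> 'a"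
  assumes rngs: "\<lbrakk>1 \<le> i; i \<le> n\<rbrakk> \<Longrightarrow> rng (R i)"
    and bimodules: "\<lbrakk>1 \<le> i; i \<le> j; j \<le> n\<rbrakk> \<Longrightarrow> bimodule (R i) (R j) (M i j)"
    and diagonal: "\<lbrakk>1 \<le> i; i \<le> n\<rbrakk> \<Longrightarrow> M i i = regular_bimodule (R i)"
    and homs: "\<lbrakk>1 \<le> i; i \<le> j; j \<le> k; k \<le> n\<rbrakk>
      \<Longrightarrow> tensor_bimodule_hom (R i) (R j) (R k) (M i j) (M j k) (M i k) (\<mu> i j k)"
    and canonical_left: "\<lbrakk>1 \<le> i; i \<le> j; j \<le> n; r \<in> carrier (R i); m \<in> carrier (M i j)\<rbrakk>
      \<Longrightarrow> \<mu> i i j r m = lact (M i j) r m"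
    and canonical_right: "\<lbrakk>1 \<le> i; i \<le> j; j \<le> n; m \<in> carrier (M i j); s \<in> carrier (R j)\<rbrakk>
      \<Longrightarrow> \<mu> i j j m s = ract (M i j) m s"
    and faithful: "\<lbrakk>1 \<le> i; i < j; j \<le> n\<rbrakk>
      \<Longrightarrow> faithful_left (R i) (M i j) \<and> faithful_right (R j) (M i j)"
    and nondegenerate: "\<lbrakk>1 \<le> i; i < j; j \<le> n; m \<in> carrier (M i j);
        \<forall>r\<in>carrier (R i). \<forall>s\<in>carrier (R j). ract (M i j) (lact (M i j) r m) s = \<zero>\<^bsub>M i j\<^esub>\<rbrakk>
      \<Longrightarrow> m = \<zero>\<^bsub>M i j\<^esub>"
    and associative: "\<lbrakk>1 \<le> i; i \<le> k; k \<le> l; l \<le> j; j \<le> n;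
        a \<in> carrier (M i k); b \<in> carrier (M k l); c \<in> carrier (M l j)\<rbrakk>
      \<Longrightarrow> \<mu> i k j a (\<mu> k l j b c) = \<mu> i l j (\<mu> i k l a b) c"

definition upper_indices :: "nat \<Rightarrow> (nat \<times> nat) set" where
  "upper_indices n = {(i, j). 1 \<le> i \<and> i \<le> j \<and> j \<le> n}"

text \<open>
  Upper triangular matrices are functions on the index pairs on and above the diagonal, so the
  zero entries below the diagonal are not stored.
\<close>

definition triangular_matrices ::
    "nat \<Rightarrow> (nat \<Rightarrow> nat \<Rightarrow> ('a, 'a, 'a) bimodule) \<Rightarrow> (nat \<Rightarrow> nat \<Rightarrow> nat \<Rightarrow> 'a \<Rightarrow> 'a \<Rightarrow> 'a)
      \<Rightarrow> (nat \<times> nat \<Rightarrow> 'a) ring" where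
  "triangular_matrices n M \<mu> =
    \<lparr>carrier = (\<Pi>\<^sub>E (i, j)\<in>upper_indices n. carrier (M i j)),
     mult = (\<lambda>A B. \<lambda>(i, j)\<in>upper_indices n. \<Oplus>\<^bsub>M i j\<^esub>k\<in>{i..j}. \<mu> i k j (A (i, k)) (B (k, j))),
     one = undefined,
     zero = (\<lambda>(i, j)\<in>upper_indices n. \<zero>\<^bsub>M i j\<^esub>),
     add = (\<lambda>A B. \<lambda>(i, j)\<in>upper_indices n. A (i, j) \<oplus>\<^bsub>M i j\<^esub> B (i, j))\<rparr>"

end

theory Submission
  imports Defs "Jordan_Normal_Form.Missing_Ring"
begin

text \<open>
  Transport the addition of $S$ to $T$ by putting $A \boxplus B = \varphi^{-1}(\varphi(A) + \varphi(B))$.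
  The bracket $p_n$, and hence every longer bracket $p_q$ with $q \equiv 1$ modulo $n - 1$, is additive
  in each argument for both additions. For $i < j$ and $r, s, t_1, \ldots$ in $R_i$, $R_j$, $R_j, \ldots$,
  the brackets $p(r, X, s, t_1, \ldots)$ and $p(X, m_{ij}, r, s, t_1, \ldots)$ isolate
  $r X_{ij} s t_1 \cdots$ and $r (m X_{jj} - X_{ii} m) s t_1 \cdots$, and by nondegeneracy and faithfulness
  these elements of $M_{ij}$ determine $X$ modulo the centre. So it suffices that the two additions
  agree on $M_{ij}$. They agree modulo the centre on $(r, u)$ and on $(s, v)$ for $u, v \in M_{ij}$,
  because one of the two summands is invisible to each of these brackets; expanding
  $p(r + u, s + v, t_1, \ldots)$ for both additions then yields the agreement for $r v t_1 \cdots$ and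
  $u s t_1 \cdots$, which suffices for $u$ and $v$ themselves.

  Finally, $w = \varphi(A + B) - \varphi(A) - \varphi(B)$ is killed by iterated brackets, and then so is
  $\varphi^{-1}(w)$, which is central because the upper Lie central series of $T$ stops at the centre.
\<close>

section \<open>Lie brackets in rings without unit\<close>

lemma lie_p_cong:
  assumes "n \<ge> 1" and "\<And>i. 1 \<le> i \<Longrightarrow> i \<le> n \<Longrightarrow> x i = y i"
  shows "lie_p R n x = lie_p R n y"
  using assms by (induction R n x rule: lie_p.induct) auto

text \<open>\<open>lie_p\<close> counts its arguments from 1 and lists count from 0, hence the shift
  \<open>i - 1\<close>. In the list form, appending argument lists composes brackets, and one
  argument can be split off without index arithmetic.\<close>

lemma lie_p_nth:
  "lie_p R (Suc (length ys)) (\<lambda>i. (x # ys) ! (i - 1)) = foldl (lie_bracket R) x ys"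
proof (induction ys rule: rev_induct)
  case (snoc y ys)
  have "lie_p R (Suc (length ys)) (\<lambda>i. (x # ys @ [y]) ! (i - 1))
      = lie_p R (Suc (length ys)) (\<lambda>i. (x # ys) ! (i - 1))"
    by (rule lie_p_cong) (auto simp: nth_Cons nth_append split: nat.splits)
  also have "\<dots> = foldl (lie_bracket R) x ys"
    by (rule snoc)
  finally have "lie_p R (Suc (length ys)) (\<lambda>i. (x # ys @ [y]) ! (i - 1))
      = foldl (lie_bracket R) x ys" .
  moreover have "(x # ys @ [y]) ! (Suc (Suc (length ys)) - 1) = y"
    by simp
  ultimately show ?case
    by (simp only: length_append list.size foldl_append foldl.simps lie_p.simps add_Suc_right
        append_Cons append_Nil add_0_right)
qed simp

lemma foldl_lie_bracket_hom:
  assumes "lie_multiplicative n R S \<phi>" and n: "n = Suc (length ys)"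
    and "x \<in> carrier R" and "set ys \<subseteq> carrier R"
  shows "\<phi> (foldl (lie_bracket R) x ys) = foldl (lie_bracket S) (\<phi> x) (map \<phi> ys)"
proof -
  let ?f = "\<lambda>i. (x # ys) ! (i - 1)"
  have "?f \<in> {1..n} \<rightarrow> carrier R"
  proof
    fix i assume "i \<in> {1..n}"
    then have "?f i \<in> set (x # ys)" using n by (intro nth_mem) auto
    then show "?f i \<in> carrier R" using assms(3,4) by auto
  qed
  then have "\<phi> (lie_p R n ?f) = lie_p S n (\<lambda>i. \<phi> (?f i))"
    using assms(1) unfolding lie_multiplicative_def by blast
  also have "\<dots> = lie_p S n (\<lambda>i. (\<phi> x # map \<phi> ys) ! (i - 1))"
    by (rule lie_p_cong) (auto simp: n nth_Cons split: nat.splits)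
  finally show ?thesis
    using lie_p_nth[of R ys x] lie_p_nth[of S "map \<phi> ys" "\<phi> x"] by (simp add: n)
qed

section \<open>Bracket calculus in a ring without unit\<close>

context rng
begin

lemmas [simp, intro] = m_closed

lemma l_null [simp]:
  assumes "x \<in> carrier R" shows "\<zero> \<otimes> x = \<zero>"
  using l_distr[of \<zero> \<zero> x] assms by simp

lemma r_null [simp]:
  assumes "x \<in> carrier R" shows "x \<otimes> \<zero> = \<zero>"
  using r_distr[of \<zero> \<zero> x] assms by simp

lemma l_minus:
  assumes "x \<in> carrier R" "y \<in> carrier R" shows "(\<ominus> x) \<otimes> y = \<ominus> (x \<otimes> y)"
  using l_distr[of "\<ominus> x" x y] assms by (simp add: l_neg minus_equality)

lemma r_minus:
  assumes "x \<in> carrier R" "y \<in> carrier R" shows "x \<otimes> (\<ominus> y) = \<ominus> (x \<otimes> y)"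
  using r_distr[of "\<ominus> y" y x] assms by (simp add: l_neg minus_equality)

lemma l_distr_diff:
  assumes "x \<in> carrier R" "y \<in> carrier R" "z \<in> carrier R"
  shows "(x \<ominus> y) \<otimes> z = x \<otimes> z \<ominus> y \<otimes> z"
  using assms by (simp add: a_minus_def l_distr l_minus)

lemma r_distr_diff:
  assumes "x \<in> carrier R" "y \<in> carrier R" "z \<in> carrier R"
  shows "z \<otimes> (x \<ominus> y) = z \<otimes> x \<ominus> z \<otimes> y"
  using assms by (simp add: a_minus_def r_distr r_minus)

lemma diff_eq_zero_iff:
  assumes "x \<in> carrier R" "y \<in> carrier R"
  shows "x \<ominus> y = \<zero> \<longleftrightarrow> x = y"
  using assms by (metis a_minus_def minus_equality minus_minus a_inv_closed r_neg)

abbreviation br where "br \<equiv> lie_bracket R"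

lemma br_closed [simp, intro]:
  "\<lbrakk>x \<in> carrier R; y \<in> carrier R\<rbrakk> \<Longrightarrow> br x y \<in> carrier R"
  by (simp add: lie_bracket_def)

lemma br_add_left:
  assumes "x \<in> carrier R" "y \<in> carrier R" "z \<in> carrier R"
  shows "br (x \<oplus> y) z = br x z \<oplus> br y z"
  using assms by (simp add: lie_bracket_def l_distr r_distr a_minus_def minus_add a_ac)

lemma br_add_right:
  assumes "x \<in> carrier R" "y \<in> carrier R" "z \<in> carrier R"
  shows "br z (x \<oplus> y) = br z x \<oplus> br z y"
  using assms by (simp add: lie_bracket_def l_distr r_distr a_minus_def minus_add a_ac)

lemma br_minus_left:
  assumes "x \<in> carrier R" "y \<in> carrier R"
  shows "br (\<ominus> x) y = \<ominus> br x y"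
  using assms by (simp add: lie_bracket_def l_minus r_minus a_minus_def minus_add a_ac)

lemma br_minus_right:
  assumes "x \<in> carrier R" "y \<in> carrier R"
  shows "br x (\<ominus> y) = \<ominus> br x y"
  using assms by (simp add: lie_bracket_def l_minus r_minus a_minus_def minus_add a_ac)

lemma br_diff_left:
  assumes "x \<in> carrier R" "y \<in> carrier R" "z \<in> carrier R"
  shows "br (x \<ominus> y) z = br x z \<ominus> br y z"
  using assms by (simp add: a_minus_def br_add_left br_minus_left)

lemma br_swap:
  assumes "x \<in> carrier R" "y \<in> carrier R"
  shows "\<ominus> br x y = br y x"
  using assms by (simp add: lie_bracket_def a_minus_def minus_add a_ac)

lemma br_self [simp]: "x \<in> carrier R \<Longrightarrow> br x x = \<zero>"
  by (simp add: lie_bracket_def a_minus_def r_neg)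

lemma br_zero_left [simp]: "x \<in> carrier R \<Longrightarrow> br \<zero> x = \<zero>"
  by (simp add: lie_bracket_def a_minus_def)

lemma br_zero_right [simp]: "x \<in> carrier R \<Longrightarrow> br x \<zero> = \<zero>"
  by (simp add: lie_bracket_def a_minus_def)

text \<open>With k entries in \<open>ys\<close>, \<open>iter x ys\<close> is the bracket p_{k+1}
  with first argument \<open>x\<close>. All length conditions below therefore count brackets, which
  is one less than the number of arguments.\<close>

abbreviation iter where "iter \<equiv> foldl br"

lemma iter_closed [simp, intro]:
  "\<lbrakk>x \<in> carrier R; set ys \<subseteq> carrier R\<rbrakk> \<Longrightarrow> iter x ys \<in> carrier R"
  by (induction ys arbitrary: x) auto

lemma iter_zero: "set ys \<subseteq> carrier R \<Longrightarrow> iter \<zero> ys = \<zero>"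
  by (induction ys) auto

lemma iter_add:
  "\<lbrakk>x \<in> carrier R; y \<in> carrier R; set zs \<subseteq> carrier R\<rbrakk>
    \<Longrightarrow> iter (x \<oplus> y) zs = iter x zs \<oplus> iter y zs"
  by (induction zs arbitrary: x y) (auto simp: br_add_left)

lemma iter_diff:
  "\<lbrakk>x \<in> carrier R; y \<in> carrier R; set zs \<subseteq> carrier R\<rbrakk>
    \<Longrightarrow> iter (x \<ominus> y) zs = iter x zs \<ominus> iter y zs"
  by (induction zs arbitrary: x y) (auto simp: br_diff_left)

lemma ring_center_iff: "z \<in> ring_center R \<longleftrightarrow> z \<in> carrier R \<and> (\<forall>x\<in>carrier R. br z x = \<zero>)"
  by (auto simp: ring_center_def lie_bracket_def diff_eq_zero_iff)

end

section \<open>Rings with a triangular Peirce decomposition\<close>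

text \<open>
  \<open>E i j\<close> is the set of matrices whose only nonzero entry is at \<open>(i, j)\<close>; it is empty
  unless \<open>(i, j)\<close> is an index pair on or above the diagonal.
\<close>

locale peirce_rng = rng +
  fixes E :: "'i::linorder \<Rightarrow> 'i \<Rightarrow> 'a set"
  assumes E_carrier: "x \<in> E i j \<Longrightarrow> x \<in> carrier R"
    and E_diff: "\<lbrakk>x \<in> E i j; y \<in> E i j\<rbrakk> \<Longrightarrow> x \<ominus> y \<in> E i j"
    and E_mult: "\<lbrakk>x \<in> E i j; y \<in> E j k\<rbrakk> \<Longrightarrow> x \<otimes> y \<in> E i k"
    and E_orth: "\<lbrakk>x \<in> E i j; y \<in> E k l; j \<noteq> k\<rbrakk> \<Longrightarrow> x \<otimes> y = \<zero>"
    and corner: "\<lbrakk>a \<in> E i i; X \<in> carrier R; b \<in> E j j; i < j\<rbrakk> \<Longrightarrow> a \<otimes> X \<otimes> b \<in> E i j"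
    and lower_corner: "\<lbrakk>a \<in> E i i; X \<in> carrier R; b \<in> E j j; i < j\<rbrakk> \<Longrightarrow> b \<otimes> X \<otimes> a = \<zero>"
    and E_nondegenerate:
      "\<lbrakk>x \<in> E i j; i < j; \<And>a b. \<lbrakk>a \<in> E i i; b \<in> E j j\<rbrakk> \<Longrightarrow> a \<otimes> x \<otimes> b = \<zero>\<rbrakk> \<Longrightarrow> x = \<zero>"
    and centralI:
      "\<lbrakk>X \<in> carrier R;
        \<And>i j a b. \<lbrakk>i < j; a \<in> E i i; b \<in> E j j\<rbrakk> \<Longrightarrow> a \<otimes> X \<otimes> b = \<zero>;
        \<And>i j a b m. \<lbrakk>i < j; a \<in> E i i; b \<in> E j j; m \<in> E i j\<rbrakk> \<Longrightarrow> a \<otimes> br m X \<otimes> b = \<zero>\<rbrakk>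
       \<Longrightarrow> X \<in> ring_center R"
begin

text \<open>Expanding [[a,X],b] gives aXb - Xab - baX + bXa. The two middle terms vanish by
  orthogonality and the last one because X is upper triangular.\<close>

lemma br_br_corner:
  assumes "a \<in> E i i" "b \<in> E j j" "i < j" and X: "X \<in> carrier R"
  shows "br (br a X) b = a \<otimes> X \<otimes> b"
proof -
  have c: "a \<in> carrier R" "b \<in> carrier R" using assms E_carrier by auto
  have "a \<otimes> b = \<zero>" "b \<otimes> a = \<zero>" "b \<otimes> X \<otimes> a = \<zero>"
    using assms by (auto intro: E_orth lower_corner)
  moreover have "X \<otimes> a \<otimes> b = X \<otimes> (a \<otimes> b)" "b \<otimes> (a \<otimes> X) = (b \<otimes> a) \<otimes> X"
    "b \<otimes> (X \<otimes> a) = b \<otimes> X \<otimes> a"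
    using c X by (simp_all add: m_assoc)
  ultimately show ?thesis
    using c X by (simp add: lie_bracket_def l_distr_diff r_distr_diff) (simp add: a_minus_def)
qed

text \<open>This variant has X in the first slot. Two swaps, of [X,m] with a and of X with m, each
  contribute a sign, and the signs cancel.\<close>

lemma br_br_br_corner:
  assumes "a \<in> E i i" "b \<in> E j j" "m \<in> E i j" "i < j" and X: "X \<in> carrier R"
  shows "br (br (br X m) a) b = a \<otimes> br m X \<otimes> b"
proof -
  have c: "a \<in> carrier R" "b \<in> carrier R" "m \<in> carrier R" using assms E_carrier by auto
  have "br (br (br X m) a) b = br (\<ominus> br a (br X m)) b"
    using c X by (simp add: br_swap)
  also have "\<dots> = \<ominus> (a \<otimes> br X m \<otimes> b)"
    using c X assms by (simp add: br_minus_left br_br_corner)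
  also have "\<dots> = a \<otimes> (\<ominus> br X m) \<otimes> b"
    using c X by (simp add: l_minus r_minus)
  finally show ?thesis using c X by (simp add: br_swap)
qed

text \<open>The other product \<open>t \<otimes> e\<close> is zero because j differs from i. Further
  brackets with elements of R_j are thus right multiplications and can lengthen a bracket as far as
  needed.\<close>

lemma br_E_diagonal:
  assumes "e \<in> E i j" "t \<in> E j j" "i < j"
  shows "br e t = e \<otimes> t"
  using assms E_carrier[OF assms(1)] E_carrier[OF assms(2)] E_orth[OF assms(2,1)]
  by (simp add: lie_bracket_def a_minus_def)

lemma iter_E:
  assumes "e \<in> E i j" "set ts \<subseteq> E j j" "i < j"
  shows "iter e ts \<in> E i j"
  using assms(1,2)
proof (induction ts arbitrary: e)
  case (Cons t ts)
  then show ?case using E_mult[of e i j t j] br_E_diagonal[OF _ _ assms(3)] by auto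
qed simp

text \<open>By induction on the length, e t = 0 for every t in R_j. Then a e b = a (e b) = 0 for all
  a and b, and nondegeneracy applies.\<close>

lemma iter_E_nondegenerate:
  assumes "e \<in> E i j" "i < j"
    and "\<And>ts. \<lbrakk>length ts = k; set ts \<subseteq> E j j\<rbrakk> \<Longrightarrow> iter e ts = \<zero>"
  shows "e = \<zero>"
  using assms(1,3)
proof (induction k arbitrary: e)
  case 0
  then show ?case using "0.prems"(2)[of "[]"] by simp
next
  case (Suc k)
  have "e \<otimes> t = \<zero>" if t: "t \<in> E j j" for t
  proof (rule Suc.IH)
    show "e \<otimes> t \<in> E i j" using E_mult Suc.prems(1) t .
    fix ts assume "length ts = k" "set ts \<subseteq> E j j"
    then show "iter (e \<otimes> t) ts = \<zero>"
      using Suc.prems(2)[of "t # ts"] br_E_diagonal[OF Suc.prems(1) t assms(2)] t by simp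
  qed
  then have "a \<otimes> e \<otimes> b = \<zero>" if "a \<in> E i i" "b \<in> E j j" for a b
    using that Suc.prems(1) E_carrier by (metis m_assoc r_null)
  then show ?case using E_nondegenerate Suc.prems(1) assms(2) by blast
qed

text \<open>For a in R_i, orthogonality gives e a = 0, so a central e also satisfies a e = 0, and
  every a e b vanishes.\<close>

lemma E_central_zero:
  assumes "e \<in> E i j" "i < j" "e \<in> ring_center R"
  shows "e = \<zero>"
proof (rule E_nondegenerate[OF assms(1,2)])
  fix a b assume ab: "a \<in> E i i" "b \<in> E j j"
  then have "a \<otimes> e = e \<otimes> a"
    using assms(3) E_carrier unfolding ring_center_def by fastforce
  also have "\<dots> = \<zero>" using E_orth[OF assms(1) ab(1)] assms(2) by simp
  finally show "a \<otimes> e \<otimes> b = \<zero>" using ab E_carrier by simp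
qed

text \<open>Both families of tests in \<open>centralI\<close> are, up to sign, brackets that start
  with W and have at least two further entries. They vanish as soon as all [[W,y],z] do.\<close>

lemma second_lie_center:
  assumes W: "W \<in> carrier R" and "\<And>y. y \<in> carrier R \<Longrightarrow> br W y \<in> ring_center R"
  shows "W \<in> ring_center R"
proof (rule centralI[OF W])
  have br3: "br (br W y) z = \<zero>" if "y \<in> carrier R" "z \<in> carrier R" for y z
    using assms(2) that by (simp add: ring_center_iff)
  fix i j :: 'i and a b assume ij: "i < j" and ab: "a \<in> E i i" "b \<in> E j j"
  have c: "a \<in> carrier R" "b \<in> carrier R" using ab E_carrier by auto
  have "a \<otimes> W \<otimes> b = br (\<ominus> br W a) b"
    using br_br_corner[OF ab ij W] c W by (simp add: br_swap)
  then show "a \<otimes> W \<otimes> b = \<zero>"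
    using c W by (simp add: br_minus_left br3)
  fix m assume m: "m \<in> E i j"
  show "a \<otimes> br m W \<otimes> b = \<zero>"
    using br_br_br_corner[OF ab m ij W] c E_carrier[OF m] by (simp add: br3)
qed

text \<open>Each [W,y] is killed by one bracket fewer, hence central by induction, and
  \<open>second_lie_center\<close> removes the remaining step.\<close>

lemma upper_lie_center:
  assumes "W \<in> carrier R"
    and "\<And>ys. \<lbrakk>length ys = Suc k; set ys \<subseteq> carrier R\<rbrakk> \<Longrightarrow> iter W ys = \<zero>"
  shows "W \<in> ring_center R"
  using assms
proof (induction k arbitrary: W)
  case 0
  have "br W y = \<zero>" if "y \<in> carrier R" for y
    using "0.prems"(2)[of "[y]"] that by simp
  then show ?case using 0 by (simp add: ring_center_iff)
next
  case (Suc k)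
  show ?case
  proof (rule second_lie_center[OF Suc.prems(1)], rule Suc.IH)
    fix y assume y: "y \<in> carrier R"
    show "br W y \<in> carrier R" using y Suc.prems(1) by simp
    fix ys assume "length ys = Suc k" "set ys \<subseteq> carrier R"
    then show "iter (br W y) ys = \<zero>" using Suc.prems(2)[of "y # ys"] y by simp
  qed
qed

end

section \<open>The addition of S transported along \<phi>\<close>

locale peirce_lie_iso = peirce_rng R E + S: rng S
  for R :: "('a, 'r) ring_scheme" (structure) and E :: "'i::linorder \<Rightarrow> 'i \<Rightarrow> 'a set"
    and S :: "('b, 's) ring_scheme" +
  fixes \<phi> :: "'a \<Rightarrow> 'b" and q :: nat
  assumes bij: "bij_betw \<phi> (carrier R) (carrier S)"
    and q: "3 \<le> q"
    and hom: "\<lbrakk>x \<in> carrier R; set ys \<subseteq> carrier R; length ys = q\<rbrakk>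
      \<Longrightarrow> \<phi> (iter x ys) = S.iter (\<phi> x) (map \<phi> ys)"
    and center: "\<phi> ` ring_center R \<subseteq> ring_center S"
begin

definition bplus :: "'a \<Rightarrow> 'a \<Rightarrow> 'a" (infixl \<open>\<boxplus>\<close> 65) where
  "x \<boxplus> y = inv_into (carrier R) \<phi> (\<phi> x \<oplus>\<^bsub>S\<^esub> \<phi> y)"

lemma \<phi>_closed [simp, intro]: "x \<in> carrier R \<Longrightarrow> \<phi> x \<in> carrier S"
  using bij bij_betwE by blast

lemma \<phi>_inj: "\<lbrakk>\<phi> x = \<phi> y; x \<in> carrier R; y \<in> carrier R\<rbrakk> \<Longrightarrow> x = y"
  using bij by (auto simp: bij_betw_def inj_on_def)

lemma \<phi>_surj: "s \<in> carrier S \<Longrightarrow> \<exists>x\<in>carrier R. s = \<phi> x"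
  using bij by (auto simp: bij_betw_def)

lemma
  assumes "x \<in> carrier R" "y \<in> carrier R"
  shows bplus_closed [simp, intro]: "x \<boxplus> y \<in> carrier R"
    and \<phi>_bplus: "\<phi> (x \<boxplus> y) = \<phi> x \<oplus>\<^bsub>S\<^esub> \<phi> y"
proof -
  have "\<phi> x \<oplus>\<^bsub>S\<^esub> \<phi> y \<in> \<phi> ` carrier R"
    using assms bij by (simp add: bij_betw_def)
  then show "x \<boxplus> y \<in> carrier R" "\<phi> (x \<boxplus> y) = \<phi> x \<oplus>\<^bsub>S\<^esub> \<phi> y"
    unfolding bplus_def by (rule inv_into_into, rule f_inv_into_f)
qed

lemma \<phi>_zero: "\<phi> \<zero> = \<zero>\<^bsub>S\<^esub>"
proof -
  have "\<phi> (iter \<zero> (replicate q \<zero>)) = S.iter (\<phi> \<zero>) (map \<phi> (replicate q \<zero>))"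
    by (rule hom) auto
  also have "\<dots> = S.iter (S.br (\<phi> \<zero>) (\<phi> \<zero>)) (replicate (q - 1) (\<phi> \<zero>))"
    using q by (cases q) (auto simp: map_replicate)
  also have "\<dots> = \<zero>\<^bsub>S\<^esub>" by (simp add: S.iter_zero set_replicate_conv_if)
  finally show ?thesis by (simp add: iter_zero set_replicate_conv_if)
qed

lemma bplus_zero [simp]:
  assumes "x \<in> carrier R"
  shows "x \<boxplus> \<zero> = x" and "\<zero> \<boxplus> x = x"
  using assms by (auto intro!: \<phi>_inj simp: \<phi>_bplus \<phi>_zero)

text \<open>Brackets in S are additive in the first argument. \<open>hom\<close> and the injectivity
  of \<phi> carry this back to the transported addition.\<close>

lemma iter_bplus:
  assumes "x \<in> carrier R" "y \<in> carrier R" "set zs \<subseteq> carrier R" "length zs = q"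
  shows "iter (x \<boxplus> y) zs = iter x zs \<boxplus> iter y zs"
proof (rule \<phi>_inj)
  have "set (map \<phi> zs) \<subseteq> carrier S" using assms by auto
  then show "\<phi> (iter (x \<boxplus> y) zs) = \<phi> (iter x zs \<boxplus> iter y zs)"
    using assms by (simp add: hom \<phi>_bplus S.iter_add del: set_map)
qed (use assms in auto)

lemma iter_bplus_second:
  assumes "x \<in> carrier R" "y \<in> carrier R" "w \<in> carrier R" "set zs \<subseteq> carrier R" "Suc (length zs) = q"
  shows "iter w ((x \<boxplus> y) # zs) = iter w (x # zs) \<boxplus> iter w (y # zs)"
proof (rule \<phi>_inj)
  have "set (map \<phi> zs) \<subseteq> carrier S" using assms by auto
  moreover have "\<phi> (iter w (v # zs)) = S.iter (\<phi> w) (\<phi> v # map \<phi> zs)" if "v \<in> carrier R" for v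
    using hom[of w "v # zs"] assms that by simp
  ultimately show "\<phi> (iter w ((x \<boxplus> y) # zs)) = \<phi> (iter w (x # zs) \<boxplus> iter w (y # zs))"
    using assms by (simp add: \<phi>_bplus S.iter_add S.br_add_right del: set_map)
qed (use assms in auto)

definition agree :: "'a \<Rightarrow> 'a \<Rightarrow> bool" where
  "agree x y \<longleftrightarrow> (x \<boxplus> y) \<ominus> (x \<oplus> y) \<in> ring_center R"

lemma zero_central: "\<zero> \<in> ring_center R"
  by (simp add: ring_center_iff)

lemma agree_zero:
  assumes "x \<in> carrier R" shows "agree x \<zero>" "agree \<zero> x"
  using assms by (simp_all add: agree_def a_minus_def r_neg zero_central)

text \<open>Brackets do not see central summands, so agreement modulo the centre becomes equality
  after a single bracket.\<close>

lemma agree_br: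
  assumes "agree x y" "x \<in> carrier R" "y \<in> carrier R" "w \<in> carrier R"
  shows "br (x \<boxplus> y) w = br (x \<oplus> y) w" and "br w (x \<boxplus> y) = br w (x \<oplus> y)"
proof -
  have "br ((x \<boxplus> y) \<ominus> (x \<oplus> y)) w = \<zero>"
    using assms by (simp add: agree_def ring_center_iff)
  then have "br (x \<boxplus> y) w \<ominus> br (x \<oplus> y) w = \<zero>"
    using assms by (simp add: br_diff_left)
  then show *: "br (x \<boxplus> y) w = br (x \<oplus> y) w"
    using assms by (subst (asm) diff_eq_zero_iff) auto
  have "br w (x \<boxplus> y) = \<ominus> br (x \<boxplus> y) w" "br w (x \<oplus> y) = \<ominus> br (x \<oplus> y) w"
    using assms by (simp_all add: br_swap)
  with * show "br w (x \<boxplus> y) = br w (x \<oplus> y)" by simp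
qed

text \<open>Closure of \<open>E i j\<close> under \<boxplus> is not known in advance, so membership
  of \<open>x \<boxplus> y\<close> is a hypothesis. The difference of the two sums is then a central
  element of \<open>E i j\<close>, hence zero.\<close>

lemma agree_E_exact:
  assumes "x \<in> E i j" "y \<in> E i j" "x \<boxplus> y \<in> E i j" "i < j" "agree x y"
  shows "x \<boxplus> y = x \<oplus> y"
proof -
  have c: "x \<in> carrier R" "y \<in> carrier R" using assms E_carrier by auto
  \<comment> \<open>Subtracting the summands one at a time fits \<open>E_diff\<close>, which speaks
    of differences only.\<close>
  have "(x \<boxplus> y) \<ominus> (x \<oplus> y) = (x \<boxplus> y) \<ominus> x \<ominus> y"
    using c by (simp add: a_minus_def minus_add a_ac)
  then have "(x \<boxplus> y) \<ominus> (x \<oplus> y) \<in> E i j"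
    using assms by (simp add: E_diff)
  then have "(x \<boxplus> y) \<ominus> (x \<oplus> y) = \<zero>"
    using E_central_zero assms(4,5) unfolding agree_def by blast
  then show ?thesis using c by (simp add: diff_eq_zero_iff)
qed

text \<open>The corner of X is a bracket with X in its second slot, so
  \<open>iter_bplus_second\<close> applies.\<close>

lemma corner_bplus:
  assumes "i < j" "a \<in> E i i" "b \<in> E j j" "set ts \<subseteq> E j j" "Suc (length ts) = q"
    and AB: "A \<in> carrier R" "B \<in> carrier R"
  shows "iter (a \<otimes> (A \<boxplus> B) \<otimes> b) ts = iter (a \<otimes> A \<otimes> b) ts \<boxplus> iter (a \<otimes> B \<otimes> b) ts"
proof -
  obtain t ts' where ts: "ts = t # ts'" using assms(5) q by (cases ts) auto
  have t: "t \<in> E j j" "set ts' \<subseteq> E j j" "set ts' \<subseteq> carrier R"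
    using assms(4) E_carrier by (auto simp: ts)
  have c: "a \<in> carrier R" "b \<in> carrier R" "t \<in> carrier R" using assms t E_carrier by auto
  have bt: "b \<otimes> t \<in> E j j" using assms(3) t(1) E_mult by blast
  \<comment> \<open>Absorbing the first entry t into b, as the element b t of R_j, makes the list
    after a have exactly q entries: X, b t and the q - 2 entries of \<open>ts'\<close>.\<close>
  have *: "iter (a \<otimes> X \<otimes> b) ts = iter a (X # (b \<otimes> t) # ts')" if X: "X \<in> carrier R" for X
  proof -
    have "a \<otimes> X \<otimes> b \<in> E i j" using assms X by (auto intro: corner)
    then show ?thesis
      using c X t assms bt by (simp add: ts br_E_diagonal br_br_corner m_assoc)
  qed
  show ?thesis
    unfolding *[OF AB(1)] *[OF AB(2)] *[OF bplus_closed[OF AB]]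
    by (rule iter_bplus_second) (use assms(5) ts AB c t in auto)
qed

text \<open>Here X is in the first slot and m, a, b take three of the q remaining places. This is
  what the bound \<open>3 \<le> q\<close> leaves room for.\<close>

lemma br_corner_bplus:
  assumes "i < j" "a \<in> E i i" "b \<in> E j j" "m \<in> E i j" "set ts \<subseteq> E j j"
    "length ts + 3 = q"
    and AB: "A \<in> carrier R" "B \<in> carrier R"
  shows "iter (a \<otimes> br m (A \<boxplus> B) \<otimes> b) ts
    = iter (a \<otimes> br m A \<otimes> b) ts \<boxplus> iter (a \<otimes> br m B \<otimes> b) ts"
proof -
  have *: "iter (a \<otimes> br m X \<otimes> b) ts = iter X (m # a # b # ts)" if X: "X \<in> carrier R" for X
    using assms X by (simp add: br_br_br_corner)
  have "set (m # a # b # ts) \<subseteq> carrier R" using assms E_carrier by auto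
  with assms(6) AB show ?thesis
    by (simp only: * bplus_closed) (rule iter_bplus, auto)
qed

text \<open>This reduces agreement of A and B to agreement of elements of single classes
  \<open>E i j\<close>. The difference of the two sums is tested with \<open>centralI\<close>. Each
  test is lengthened by a list from R_j, without loss by \<open>iter_E_nondegenerate\<close>, so
  that it becomes a bracket compatible with both additions.\<close>

lemma agreeI:
  assumes AB: "A \<in> carrier R" "B \<in> carrier R"
    and corners: "\<And>i j a b ts. \<lbrakk>i < j; a \<in> E i i; b \<in> E j j; set ts \<subseteq> E j j; Suc (length ts) = q\<rbrakk>
      \<Longrightarrow> agree (iter (a \<otimes> A \<otimes> b) ts) (iter (a \<otimes> B \<otimes> b) ts)"
    and br_corners: "\<And>i j a b m ts. \<lbrakk>i < j; a \<in> E i i; b \<in> E j j; m \<in> E i j; set ts \<subseteq> E j j;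
        length ts + 3 = q\<rbrakk>
      \<Longrightarrow> agree (iter (a \<otimes> br m A \<otimes> b) ts) (iter (a \<otimes> br m B \<otimes> b) ts)"
  shows "agree A B"
  unfolding agree_def
proof (rule centralI)
  let ?D = "(A \<boxplus> B) \<ominus> (A \<oplus> B)"
  show D: "?D \<in> carrier R" using AB by simp
  fix i j :: 'i and a b assume ij: "i < j" and ab: "a \<in> E i i" "b \<in> E j j"
  have c: "a \<in> carrier R" "b \<in> carrier R" using ab E_carrier by auto
  show "a \<otimes> ?D \<otimes> b = \<zero>"
  proof (rule iter_E_nondegenerate)
    show "a \<otimes> ?D \<otimes> b \<in> E i j" using corner ab ij D by blast
    fix ts assume ts: "length ts = q - 1" "set ts \<subseteq> E j j"
    have len: "Suc (length ts) = q" using ts q by simp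
    have tsc: "set ts \<subseteq> carrier R" using ts E_carrier by auto
    have E: "iter (a \<otimes> X \<otimes> b) ts \<in> E i j" if "X \<in> carrier R" for X
      using that ts ab ij by (intro iter_E corner) auto
    have "iter (a \<otimes> (A \<boxplus> B) \<otimes> b) ts = iter (a \<otimes> A \<otimes> b) ts \<boxplus> iter (a \<otimes> B \<otimes> b) ts"
      using corner_bplus[OF ij ab ts(2) len AB] .
    also have "\<dots> = iter (a \<otimes> A \<otimes> b) ts \<oplus> iter (a \<otimes> B \<otimes> b) ts"
    proof (rule agree_E_exact)
      \<comment> \<open>The \<boxplus>-sum lies in \<open>E i j\<close> because it is itself the
        lengthened corner of \<open>A \<boxplus> B\<close>. The same argument serves for the second
        test below.\<close>
      show "iter (a \<otimes> A \<otimes> b) ts \<boxplus> iter (a \<otimes> B \<otimes> b) ts \<in> E i j"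
        using E[of "A \<boxplus> B"] corner_bplus[OF ij ab ts(2) len AB] AB by simp
    qed (use E AB ij corners[OF ij ab ts(2) len] in auto)
    also have "\<dots> = iter (a \<otimes> (A \<oplus> B) \<otimes> b) ts"
      using AB c tsc by (simp add: l_distr r_distr iter_add)
    finally show "iter (a \<otimes> ?D \<otimes> b) ts = \<zero>"
      using AB c tsc by (simp add: l_distr_diff r_distr_diff iter_diff diff_eq_zero_iff)
  qed (rule ij)
  fix m assume m: "m \<in> E i j"
  have mc: "m \<in> carrier R" using m E_carrier by auto
  show "a \<otimes> br m ?D \<otimes> b = \<zero>"
  proof (rule iter_E_nondegenerate)
    show "a \<otimes> br m ?D \<otimes> b \<in> E i j" using corner ab ij D mc by simp
    fix ts assume ts: "length ts = q - 3" "set ts \<subseteq> E j j"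
    have len: "length ts + 3 = q" using ts q by simp
    have tsc: "set ts \<subseteq> carrier R" using ts E_carrier by auto
    have E: "iter (a \<otimes> br m X \<otimes> b) ts \<in> E i j" if "X \<in> carrier R" for X
      using that ts ab ij mc by (intro iter_E corner) auto
    have br_diff: "br m ?D = br m (A \<boxplus> B) \<ominus> br m (A \<oplus> B)"
      using AB mc by (simp add: a_minus_def br_add_right br_minus_right minus_add)
    have "iter (a \<otimes> br m (A \<boxplus> B) \<otimes> b) ts = iter (a \<otimes> br m A \<otimes> b) ts \<boxplus> iter (a \<otimes> br m B \<otimes> b) ts"
      using br_corner_bplus[OF ij ab m ts(2) len AB] .
    also have "\<dots> = iter (a \<otimes> br m A \<otimes> b) ts \<oplus> iter (a \<otimes> br m B \<otimes> b) ts"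
    proof (rule agree_E_exact)
      show "iter (a \<otimes> br m A \<otimes> b) ts \<boxplus> iter (a \<otimes> br m B \<otimes> b) ts \<in> E i j"
        using E[of "A \<boxplus> B"] br_corner_bplus[OF ij ab m ts(2) len AB] AB by simp
    qed (use E AB ij br_corners[OF ij ab m ts(2) len] in auto)
    also have "\<dots> = iter (a \<otimes> br m (A \<oplus> B) \<otimes> b) ts"
      using AB c mc tsc by (simp add: l_distr r_distr iter_add br_add_right)
    finally show "iter (a \<otimes> br m ?D \<otimes> b) ts = \<zero>"
      using AB c mc tsc by (simp only: br_diff) (simp add: l_distr_diff r_distr_diff iter_diff diff_eq_zero_iff)
  qed (rule ij)
qed

section \<open>Agreement of the two additions on single entries\<close>

lemma E_corner_zero:
  assumes "x \<in> E k l" "a \<in> E i i" "b \<in> E j j" "(k, l) \<noteq> (i, j)"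
  shows "a \<otimes> x \<otimes> b = \<zero>"
proof (cases "k = i")
  case True
  then have "x \<otimes> b = \<zero>" using assms E_orth by blast
  then show ?thesis using assms E_carrier by (metis m_assoc r_null)
next
  case False
  then have "a \<otimes> x = \<zero>" using assms E_orth by blast
  then show ?thesis using assms E_carrier by simp
qed

text \<open>Multiplying m by a strictly upper entry moves its column to the right (m x) or its row
  upwards (x m), if the product is nonzero at all. Neither product can stay at position (i, j), so
  the corner sees nothing.\<close>

lemma E_br_corner_zero:
  assumes "x \<in> E k l" "m \<in> E i j" "a \<in> E i i" "b \<in> E j j" "k < l" "i < j"
  shows "a \<otimes> br m x \<otimes> b = \<zero>"
proof -
  have c: "x \<in> carrier R" "m \<in> carrier R" "a \<in> carrier R" "b \<in> carrier R"
    using assms E_carrier by auto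
  have 1: "a \<otimes> (m \<otimes> x) \<otimes> b = \<zero>"
  proof (cases "j = k")
    case True
    then have "m \<otimes> x \<in> E i l" using assms E_mult by blast
    then show ?thesis using E_corner_zero assms True by blast
  next
    case False
    then have "m \<otimes> x = \<zero>" using assms E_orth by blast
    then show ?thesis using c by simp
  qed
  have 2: "a \<otimes> (x \<otimes> m) \<otimes> b = \<zero>"
  proof (cases "l = i")
    case True
    then have "x \<otimes> m \<in> E k j" using assms E_mult by blast
    then show ?thesis using E_corner_zero assms True by blast
  next
    case False
    then have "x \<otimes> m = \<zero>" using assms E_orth by blast
    then show ?thesis using c by simp
  qed
  show ?thesis
    using c by (simp add: lie_bracket_def l_distr_diff r_distr_diff 1 2) (simp add: a_minus_def)
qed

text \<open>The corner tests of \<open>agreeI\<close> annihilate d, and its bracket tests annihilate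
  u. In both cases one summand is zero and \<open>agree_zero\<close> finishes.\<close>

lemma agree_diagonal_E:
  assumes d: "d \<in> E k k" and u: "u \<in> E i j" "i < j"
  shows "agree d u"
proof (rule agreeI)
  show c: "d \<in> carrier R" "u \<in> carrier R" using assms E_carrier by auto
  fix i' j' :: 'i and a b ts
  assume ij: "i' < j'" and ab: "a \<in> E i' i'" "b \<in> E j' j'" and ts: "set ts \<subseteq> E j' j'"
  have tsc: "set ts \<subseteq> carrier R" and abc: "a \<in> carrier R" "b \<in> carrier R"
    using ts ab E_carrier by auto
  have "a \<otimes> d \<otimes> b = \<zero>" using d ab ij by (intro E_corner_zero) auto
  then show "agree (iter (a \<otimes> d \<otimes> b) ts) (iter (a \<otimes> u \<otimes> b) ts)"
    using tsc abc c by (simp add: iter_zero agree_zero)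
  fix m assume m: "m \<in> E i' j'"
  have "a \<otimes> br m u \<otimes> b = \<zero>" using E_br_corner_zero[OF u(1) m ab u(2) ij] .
  then show "agree (iter (a \<otimes> br m d \<otimes> b) ts) (iter (a \<otimes> br m u \<otimes> b) ts)"
    using tsc abc c E_carrier[OF m] by (simp add: iter_zero agree_zero)
qed

text \<open>Expand the bracket of \<open>a + u\<close> and \<open>b + v\<close> with respect to both additions.\<close>

lemma bplus_eq_add_products:
  assumes ij: "i < j" and ab: "a \<in> E i i" "b \<in> E j j" and uv: "u \<in> E i j" "v \<in> E i j"
    and ts: "set ts \<subseteq> E j j" "Suc (length ts) = q"
  shows "iter (a \<otimes> v) ts \<boxplus> iter (u \<otimes> b) ts = iter (a \<otimes> v) ts \<oplus> iter (u \<otimes> b) ts"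
proof -
  have c: "a \<in> carrier R" "b \<in> carrier R" "u \<in> carrier R" "v \<in> carrier R" "set ts \<subseteq> carrier R"
    using ab uv ts E_carrier by auto
  have z: "a \<otimes> b = \<zero>" "b \<otimes> a = \<zero>" "u \<otimes> v = \<zero>" "v \<otimes> u = \<zero>" "v \<otimes> a = \<zero>" "b \<otimes> u = \<zero>"
    using ij ab uv by (auto intro: E_orth)
  have brs: "br a b = \<zero>" "br u v = \<zero>" "br a v = a \<otimes> v" "br u b = u \<otimes> b"
    using c by (simp_all add: lie_bracket_def z) (simp_all add: a_minus_def)
  \<comment> \<open>By \<open>agree_diagonal_E\<close>, each \<boxplus> differs from the ordinary
    sum by a central element, which the first bracket removes.\<close>
  have "iter (a \<boxplus> u) ((b \<boxplus> v) # ts) = iter (br (a \<oplus> u) (b \<oplus> v)) ts"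
    using c agree_br agree_diagonal_E ab uv ij by simp
  also have "\<dots> = iter (a \<otimes> v) ts \<oplus> iter (u \<otimes> b) ts"
    using c by (simp add: br_add_left br_add_right brs iter_add a_comm)
  finally have 1: "iter (a \<boxplus> u) ((b \<boxplus> v) # ts) = iter (a \<otimes> v) ts \<oplus> iter (u \<otimes> b) ts" .
  \<comment> \<open>Now the same bracket is expanded for \<boxplus>, first in slot one and then in
    slot two. Of the four resulting terms, those with [a,b] and [u,v] are zero.\<close>
  have "iter (a \<boxplus> u) ((b \<boxplus> v) # ts) = iter a ((b \<boxplus> v) # ts) \<boxplus> iter u ((b \<boxplus> v) # ts)"
    by (rule iter_bplus) (use c ts in auto)
  also have "iter a ((b \<boxplus> v) # ts) = iter (br a b) ts \<boxplus> iter (br a v) ts"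
    using iter_bplus_second[of b v a ts] c ts by simp
  also have "iter u ((b \<boxplus> v) # ts) = iter (br u b) ts \<boxplus> iter (br u v) ts"
    using iter_bplus_second[of b v u ts] c ts by simp
  finally have "iter (a \<boxplus> u) ((b \<boxplus> v) # ts) = iter (a \<otimes> v) ts \<boxplus> iter (u \<otimes> b) ts"
    using c by (simp add: brs iter_zero)
  with 1 show ?thesis by simp
qed

text \<open>The bracket tests annihilate both u and v, and so do the corner tests at any position
  other than (i, j). Only the corner test at (i, j) has content.\<close>

lemma agree_E:
  assumes uv: "u \<in> E i j" "v \<in> E i j" and ij: "i < j"
  shows "agree u v"
proof (rule agreeI)
  show c: "u \<in> carrier R" "v \<in> carrier R" using assms E_carrier by auto
  fix i' j' :: 'i and a b ts
  assume ij': "i' < j'" and ab: "a \<in> E i' i'" "b \<in> E j' j'" and ts: "set ts \<subseteq> E j' j'"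
  have tsc: "set ts \<subseteq> carrier R" and abc: "a \<in> carrier R" "b \<in> carrier R"
    using ts ab E_carrier by auto
  show "agree (iter (a \<otimes> u \<otimes> b) ts) (iter (a \<otimes> v \<otimes> b) ts)" if len: "Suc (length ts) = q"
  proof (cases "(i, j) = (i', j')")
    case True
    then have "u \<otimes> b \<in> E i' j'" "a \<otimes> v \<in> E i' j'" using uv ab E_mult by blast+
    \<comment> \<open>The lemma is applied with a v in the role of its u and u b in the role of its
      v. Its two products are then a (u b) and (a v) b, the two corners in question.\<close>
    from bplus_eq_add_products[OF ij' ab this(2,1) ts len]
    have "iter (a \<otimes> u \<otimes> b) ts \<boxplus> iter (a \<otimes> v \<otimes> b) ts = iter (a \<otimes> u \<otimes> b) ts \<oplus> iter (a \<otimes> v \<otimes> b) ts"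
      using abc c by (simp add: m_assoc)
    then show ?thesis
      using abc c tsc by (simp add: agree_def a_minus_def r_neg zero_central)
  next
    case False
    then have "a \<otimes> u \<otimes> b = \<zero>" "a \<otimes> v \<otimes> b = \<zero>" using E_corner_zero uv ab by blast+
    then show ?thesis using tsc by (simp add: iter_zero agree_zero)
  qed
  fix m assume m: "m \<in> E i' j'"
  have "a \<otimes> br m u \<otimes> b = \<zero>" "a \<otimes> br m v \<otimes> b = \<zero>" using E_br_corner_zero m ab uv ij ij' by blast+
  then show "agree (iter (a \<otimes> br m u \<otimes> b) ts) (iter (a \<otimes> br m v \<otimes> b) ts)"
    using tsc by (simp add: iter_zero agree_zero)
qed

text \<open>After \<open>agreeI\<close>, both arguments of every test are lengthened corners, hence
  lie in a common \<open>E i j\<close> where \<open>agree_E\<close> applies.\<close>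

lemma agree_all:
  assumes "A \<in> carrier R" "B \<in> carrier R"
  shows "agree A B"
proof (rule agreeI[OF assms])
  fix i j :: 'i and a b ts
  assume *: "i < j" "a \<in> E i i" "b \<in> E j j" "set ts \<subseteq> E j j"
  have E: "iter (a \<otimes> X \<otimes> b) ts \<in> E i j" if "X \<in> carrier R" for X
    using that * by (intro iter_E corner) auto
  show "agree (iter (a \<otimes> A \<otimes> b) ts) (iter (a \<otimes> B \<otimes> b) ts)"
    using agree_E[OF E E] assms * by blast
  fix m assume "m \<in> E i j"
  then have "br m A \<in> carrier R" "br m B \<in> carrier R" using assms E_carrier by auto
  then show "agree (iter (a \<otimes> br m A \<otimes> b) ts) (iter (a \<otimes> br m B \<otimes> b) ts)"
    using agree_E[OF E E] * by blast
qed

theorem almost_additive: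
  assumes AB: "A \<in> carrier R" "B \<in> carrier R"
  shows "\<exists>Z\<in>ring_center S. \<phi> (A \<oplus> B) = \<phi> A \<oplus>\<^bsub>S\<^esub> \<phi> B \<oplus>\<^bsub>S\<^esub> Z"
proof -
  let ?w = "\<phi> (A \<oplus> B) \<ominus>\<^bsub>S\<^esub> \<phi> (A \<boxplus> B)"
  have wc: "?w \<in> carrier S" using AB by simp
  \<comment> \<open>Centrality is proved for the preimage W, since \<phi> is known to carry centre
    into centre only in this direction.\<close>
  then obtain W where W: "W \<in> carrier R" "?w = \<phi> W" using \<phi>_surj by blast
  obtain k where k: "q = Suc k" using q by (cases q) auto
  have "W \<in> ring_center R"
  proof (rule upper_lie_center[OF W(1)])
    fix ys assume ys: "length ys = Suc k" "set ys \<subseteq> carrier R"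
    then obtain y zs where yz: "ys = y # zs" by (cases ys) auto
    have mys: "set (map \<phi> ys) \<subseteq> carrier S" using ys by auto
    \<comment> \<open>\<open>A \<oplus> B\<close> and \<open>A \<boxplus> B\<close> agree modulo the
      centre, so they already coincide after the bracket with the first entry y.\<close>
    have "iter (A \<oplus> B) ys = iter (A \<boxplus> B) ys"
      using agree_br(1)[OF agree_all[OF AB] AB] ys by (simp add: yz)
    then have eq: "S.iter (\<phi> (A \<oplus> B)) (map \<phi> ys) = S.iter (\<phi> (A \<boxplus> B)) (map \<phi> ys)"
      using hom[of "A \<oplus> B" ys] hom[of "A \<boxplus> B" ys] AB ys k by simp
    have "\<phi> (iter W ys) = S.iter ?w (map \<phi> ys)"
      using hom[of W ys] W ys k by simp
    also have "\<dots> = S.iter (\<phi> (A \<oplus> B)) (map \<phi> ys) \<ominus>\<^bsub>S\<^esub> S.iter (\<phi> (A \<boxplus> B)) (map \<phi> ys)"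
      using AB mys by (intro S.iter_diff) auto
    also have "\<dots> = \<zero>\<^bsub>S\<^esub>"
      using eq AB mys by (subst S.diff_eq_zero_iff) (auto simp del: set_map)
    finally have "\<phi> (iter W ys) = \<phi> \<zero>" by (simp add: \<phi>_zero)
    then show "iter W ys = \<zero>"
      by (rule \<phi>_inj) (use W ys in auto)
  qed
  then have "?w \<in> ring_center S" using center W(2) by auto
  moreover have "\<phi> (A \<oplus> B) = \<phi> A \<oplus>\<^bsub>S\<^esub> \<phi> B \<oplus>\<^bsub>S\<^esub> ?w"
  proof -
    have "s = t \<oplus>\<^bsub>S\<^esub> (s \<ominus>\<^bsub>S\<^esub> t)" if "s \<in> carrier S" "t \<in> carrier S" for s t
      using that by (simp add: a_minus_def S.a_lcomm S.r_neg)
    from this[of "\<phi> (A \<oplus> B)" "\<phi> (A \<boxplus> B)"] show ?thesis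
      using AB by (simp add: \<phi>_bplus)
  qed
  ultimately show ?thesis by blast
qed

end

section \<open>Triangular matrix rings\<close>

context triangular_matrix_ring
begin

abbreviation T where "T \<equiv> triangular_matrices n M \<mu>"

abbreviation index where "index i j \<equiv> 1 \<le> i \<and> i \<le> j \<and> j \<le> n"

lemma M_abelian_group: "index i j \<Longrightarrow> abelian_group (M i j)"
  using bimodules bimodule.axioms(3) by blast

lemma carrier_diagonal [simp]: "\<lbrakk>1 \<le> i; i \<le> n\<rbrakk> \<Longrightarrow> carrier (M i i) = carrier (R i)"
  and zero_diagonal [simp]: "\<lbrakk>1 \<le> i; i \<le> n\<rbrakk> \<Longrightarrow> \<zero>\<^bsub>M i i\<^esub> = \<zero>\<^bsub>R i\<^esub>"
  and lact_diagonal [simp]: "\<lbrakk>1 \<le> i; i \<le> n\<rbrakk> \<Longrightarrow> lact (M i i) a b = a \<otimes>\<^bsub>R i\<^esub> b"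
  using diagonal by (auto simp: regular_bimodule_def ring.extend_def bimodule.fields_def)

lemma \<mu>_closed:
  "\<lbrakk>1 \<le> i; i \<le> j; j \<le> k; k \<le> n; a \<in> carrier (M i j); b \<in> carrier (M j k)\<rbrakk>
    \<Longrightarrow> \<mu> i j k a b \<in> carrier (M i k)"
  using tensor_bimodule_hom.hom_closed[OF homs] by blast

lemma \<mu>_add_left:
  "\<lbrakk>1 \<le> i; i \<le> j; j \<le> k; k \<le> n; a \<in> carrier (M i j); a' \<in> carrier (M i j); b \<in> carrier (M j k)\<rbrakk>
    \<Longrightarrow> \<mu> i j k (a \<oplus>\<^bsub>M i j\<^esub> a') b = \<mu> i j k a b \<oplus>\<^bsub>M i k\<^esub> \<mu> i j k a' b"
  using tensor_bimodule_hom.hom_add_left[OF homs] by blast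

lemma \<mu>_add_right:
  "\<lbrakk>1 \<le> i; i \<le> j; j \<le> k; k \<le> n; a \<in> carrier (M i j); b \<in> carrier (M j k); b' \<in> carrier (M j k)\<rbrakk>
    \<Longrightarrow> \<mu> i j k a (b \<oplus>\<^bsub>M j k\<^esub> b') = \<mu> i j k a b \<oplus>\<^bsub>M i k\<^esub> \<mu> i j k a b'"
  using tensor_bimodule_hom.hom_add_right[OF homs] by blast

lemma \<mu>_zero_left:
  assumes "1 \<le> i" "i \<le> j" "j \<le> k" "k \<le> n" "b \<in> carrier (M j k)"
  shows "\<mu> i j k \<zero>\<^bsub>M i j\<^esub> b = \<zero>\<^bsub>M i k\<^esub>"
proof -
  interpret ij: abelian_group "M i j" using assms by (intro M_abelian_group) auto
  interpret ik: abelian_group "M i k" using assms by (intro M_abelian_group) auto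
  have "\<mu> i j k \<zero>\<^bsub>M i j\<^esub> b \<oplus>\<^bsub>M i k\<^esub> \<mu> i j k \<zero>\<^bsub>M i j\<^esub> b = \<mu> i j k \<zero>\<^bsub>M i j\<^esub> b"
    using \<mu>_add_left[of i j k "\<zero>\<^bsub>M i j\<^esub>" "\<zero>\<^bsub>M i j\<^esub>" b] assms by simp
  then show ?thesis using \<mu>_closed assms by simp
qed

lemma \<mu>_zero_right:
  assumes "1 \<le> i" "i \<le> j" "j \<le> k" "k \<le> n" "a \<in> carrier (M i j)"
  shows "\<mu> i j k a \<zero>\<^bsub>M j k\<^esub> = \<zero>\<^bsub>M i k\<^esub>"
proof -
  interpret jk: abelian_group "M j k" using assms by (intro M_abelian_group) auto
  interpret ik: abelian_group "M i k" using assms by (intro M_abelian_group) auto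
  have "\<mu> i j k a \<zero>\<^bsub>M j k\<^esub> \<oplus>\<^bsub>M i k\<^esub> \<mu> i j k a \<zero>\<^bsub>M j k\<^esub> = \<mu> i j k a \<zero>\<^bsub>M j k\<^esub>"
    using \<mu>_add_right[of i j k a "\<zero>\<^bsub>M j k\<^esub>" "\<zero>\<^bsub>M j k\<^esub>"] assms by simp
  then show ?thesis using \<mu>_closed assms by simp
qed

lemma \<mu>_finsum_left:
  assumes "1 \<le> i" "i \<le> j" "j \<le> k" "k \<le> n" "b \<in> carrier (M j k)"
    and "finite L" "\<And>l. l \<in> L \<Longrightarrow> f l \<in> carrier (M i j)"
  shows "\<mu> i j k (\<Oplus>\<^bsub>M i j\<^esub>l\<in>L. f l) b = (\<Oplus>\<^bsub>M i k\<^esub>l\<in>L. \<mu> i j k (f l) b)"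
proof -
  interpret ij: abelian_group "M i j" using assms by (intro M_abelian_group) auto
  interpret ik: abelian_group "M i k" using assms by (intro M_abelian_group) auto
  show ?thesis
    using assms(6,7)
  proof (induction L rule: finite_induct)
    case empty
    then show ?case using \<mu>_zero_left assms by simp
  next
    case (insert l L)
    then show ?case
      using assms(1-5) by (simp add: ij.finsum_insert ik.finsum_insert Pi_def \<mu>_closed \<mu>_add_left)
  qed
qed

lemma \<mu>_finsum_right:
  assumes "1 \<le> i" "i \<le> j" "j \<le> k" "k \<le> n" "a \<in> carrier (M i j)"
    and "finite L" "\<And>l. l \<in> L \<Longrightarrow> f l \<in> carrier (M j k)"
  shows "\<mu> i j k a (\<Oplus>\<^bsub>M j k\<^esub>l\<in>L. f l) = (\<Oplus>\<^bsub>M i k\<^esub>l\<in>L. \<mu> i j k a (f l))"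
proof -
  interpret jk: abelian_group "M j k" using assms by (intro M_abelian_group) auto
  interpret ik: abelian_group "M i k" using assms by (intro M_abelian_group) auto
  show ?thesis
    using assms(6,7)
  proof (induction L rule: finite_induct)
    case empty
    then show ?case using \<mu>_zero_right assms by simp
  next
    case (insert l L)
    then show ?case
      using assms(1-5) by (simp add: jk.finsum_insert ik.finsum_insert Pi_def \<mu>_closed \<mu>_add_right)
  qed
qed

lemma carrier_T: "carrier T = (\<Pi>\<^sub>E (i, j)\<in>upper_indices n. carrier (M i j))"
  by (simp add: triangular_matrices_def)

lemma T_entry: "\<lbrakk>A \<in> carrier T; index i j\<rbrakk> \<Longrightarrow> A (i, j) \<in> carrier (M i j)"
  unfolding carrier_T upper_indices_def by (force dest: PiE_mem)

lemma T_ext: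
  assumes "A \<in> carrier T" "B \<in> carrier T" "\<And>i j. index i j \<Longrightarrow> A (i, j) = B (i, j)"
  shows "A = B"
  using assms(1,2) unfolding carrier_T
  by (rule PiE_ext) (use assms(3) in \<open>auto simp: upper_indices_def\<close>)

lemma T_restrictI:
  "(\<And>i j. index i j \<Longrightarrow> f i j \<in> carrier (M i j)) \<Longrightarrow> (\<lambda>(i, j)\<in>upper_indices n. f i j) \<in> carrier T"
  unfolding carrier_T upper_indices_def by (auto intro!: restrict_PiE_iff[THEN iffD2])

lemma mult_entry:
  "index i j \<Longrightarrow> (A \<otimes>\<^bsub>T\<^esub> B) (i, j) = (\<Oplus>\<^bsub>M i j\<^esub>k\<in>{i..j}. \<mu> i k j (A (i, k)) (B (k, j)))"
  and add_entry: "index i j \<Longrightarrow> (A \<oplus>\<^bsub>T\<^esub> B) (i, j) = A (i, j) \<oplus>\<^bsub>M i j\<^esub> B (i, j)"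
  and zero_entry: "index i j \<Longrightarrow> \<zero>\<^bsub>T\<^esub> (i, j) = \<zero>\<^bsub>M i j\<^esub>"
  by (simp_all add: triangular_matrices_def upper_indices_def)

lemma T_add_closed:
  assumes "A \<in> carrier T" "B \<in> carrier T"
  shows "A \<oplus>\<^bsub>T\<^esub> B \<in> carrier T"
proof -
  have "(\<lambda>(i, j)\<in>upper_indices n. A (i, j) \<oplus>\<^bsub>M i j\<^esub> B (i, j)) \<in> carrier T"
  proof (rule T_restrictI)
    fix i j assume ij: "index i j"
    interpret abelian_group "M i j" using ij by (rule M_abelian_group)
    show "A (i, j) \<oplus>\<^bsub>M i j\<^esub> B (i, j) \<in> carrier (M i j)" using T_entry ij assms by auto
  qed
  then show ?thesis by (simp add: triangular_matrices_def)
qed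

lemma T_zero_closed: "\<zero>\<^bsub>T\<^esub> \<in> carrier T"
proof -
  have "(\<lambda>(i, j)\<in>upper_indices n. \<zero>\<^bsub>M i j\<^esub>) \<in> carrier T"
    by (rule T_restrictI) (rule abelian_monoid.zero_closed,
        use M_abelian_group abelian_group.axioms(1) in blast)
  then show ?thesis by (simp add: triangular_matrices_def)
qed

lemma product_entry:
  "\<lbrakk>A \<in> carrier T; B \<in> carrier T; index i j; i \<le> k; k \<le> j\<rbrakk>
    \<Longrightarrow> \<mu> i k j (A (i, k)) (B (k, j)) \<in> carrier (M i j)"
  by (rule \<mu>_closed) (auto intro: T_entry)

lemma T_mult_closed:
  assumes "A \<in> carrier T" "B \<in> carrier T"
  shows "A \<otimes>\<^bsub>T\<^esub> B \<in> carrier T"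
proof -
  have "(\<lambda>(i, j)\<in>upper_indices n. \<Oplus>\<^bsub>M i j\<^esub>k\<in>{i..j}. \<mu> i k j (A (i, k)) (B (k, j))) \<in> carrier T"
  proof (rule T_restrictI)
    fix i j assume ij: "index i j"
    interpret abelian_group "M i j" using ij by (rule M_abelian_group)
    show "(\<Oplus>\<^bsub>M i j\<^esub>k\<in>{i..j}. \<mu> i k j (A (i, k)) (B (k, j))) \<in> carrier (M i j)"
      using product_entry[OF assms ij] by (intro finsum_closed) auto
  qed
  then show ?thesis by (simp add: triangular_matrices_def)
qed

lemma T_abelian_group: "abelian_group T"
proof (rule abelian_groupI)
  show "\<zero>\<^bsub>T\<^esub> \<in> carrier T" by (rule T_zero_closed)
  fix A assume A: "A \<in> carrier T"
  show "\<zero>\<^bsub>T\<^esub> \<oplus>\<^bsub>T\<^esub> A = A"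
  proof (rule T_ext)
    fix i j assume ij: "index i j"
    interpret abelian_group "M i j" using ij by (rule M_abelian_group)
    show "(\<zero>\<^bsub>T\<^esub> \<oplus>\<^bsub>T\<^esub> A) (i, j) = A (i, j)"
      using T_entry[OF A ij] ij by (simp add: add_entry zero_entry)
  qed (auto intro: T_add_closed T_zero_closed A)
  let ?N = "\<lambda>(i, j)\<in>upper_indices n. \<ominus>\<^bsub>M i j\<^esub> A (i, j)"
  have N: "?N \<in> carrier T"
  proof (rule T_restrictI)
    fix i j assume ij: "index i j"
    interpret abelian_group "M i j" using ij by (rule M_abelian_group)
    show "\<ominus>\<^bsub>M i j\<^esub> A (i, j) \<in> carrier (M i j)" using T_entry[OF A ij] by simp
  qed
  have "?N \<oplus>\<^bsub>T\<^esub> A = \<zero>\<^bsub>T\<^esub>"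
  proof (rule T_ext)
    fix i j assume ij: "index i j"
    interpret abelian_group "M i j" using ij by (rule M_abelian_group)
    have "?N (i, j) = \<ominus>\<^bsub>M i j\<^esub> A (i, j)" using ij by (simp add: upper_indices_def)
    then show "(?N \<oplus>\<^bsub>T\<^esub> A) (i, j) = \<zero>\<^bsub>T\<^esub> (i, j)"
      using T_entry[OF A ij] ij by (simp add: add_entry zero_entry l_neg)
  qed (auto intro: T_add_closed T_zero_closed A N)
  with N show "\<exists>B\<in>carrier T. B \<oplus>\<^bsub>T\<^esub> A = \<zero>\<^bsub>T\<^esub>" by blast
  fix B assume B: "B \<in> carrier T"
  show "A \<oplus>\<^bsub>T\<^esub> B \<in> carrier T" using A B by (rule T_add_closed)
  show "A \<oplus>\<^bsub>T\<^esub> B = B \<oplus>\<^bsub>T\<^esub> A"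
  proof (rule T_ext)
    fix i j assume ij: "index i j"
    interpret abelian_group "M i j" using ij by (rule M_abelian_group)
    show "(A \<oplus>\<^bsub>T\<^esub> B) (i, j) = (B \<oplus>\<^bsub>T\<^esub> A) (i, j)"
      using T_entry[OF A ij] T_entry[OF B ij] ij by (simp add: add_entry a_comm)
  qed (auto intro: T_add_closed A B)
  fix C assume C: "C \<in> carrier T"
  show "A \<oplus>\<^bsub>T\<^esub> B \<oplus>\<^bsub>T\<^esub> C = A \<oplus>\<^bsub>T\<^esub> (B \<oplus>\<^bsub>T\<^esub> C)"
  proof (rule T_ext)
    fix i j assume ij: "index i j"
    interpret abelian_group "M i j" using ij by (rule M_abelian_group)
    show "(A \<oplus>\<^bsub>T\<^esub> B \<oplus>\<^bsub>T\<^esub> C) (i, j) = (A \<oplus>\<^bsub>T\<^esub> (B \<oplus>\<^bsub>T\<^esub> C)) (i, j)"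
      using T_entry[OF A ij] T_entry[OF B ij] T_entry[OF C ij] ij by (simp add: add_entry a_assoc)
  qed (auto intro: T_add_closed A B C)
qed

lemma T_mult_assoc:
  assumes A: "A \<in> carrier T" and B: "B \<in> carrier T" and C: "C \<in> carrier T"
  shows "A \<otimes>\<^bsub>T\<^esub> B \<otimes>\<^bsub>T\<^esub> C = A \<otimes>\<^bsub>T\<^esub> (B \<otimes>\<^bsub>T\<^esub> C)"
proof (rule T_ext)
  fix i j assume ij: "index i j"
  interpret abelian_group "M i j" using ij by (rule M_abelian_group)
  \<comment> \<open>Extending the triple products by zero to pairs with l > k turns the triangular
    double sum into one over a square, where the order of summation can be exchanged.\<close>
  define g where "g l k = (if l \<le> k then \<mu> i k j (\<mu> i l k (A (i, l)) (B (l, k))) (C (k, j))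
    else \<zero>\<^bsub>M i j\<^esub>)" for l k
  have AB: "\<mu> i l k (A (i, l)) (B (l, k)) \<in> carrier (M i k)" if "i \<le> l" "l \<le> k" "k \<le> j" for l k
    using that ij A B by (intro product_entry) auto
  have BC: "\<mu> l k j (B (l, k)) (C (k, j)) \<in> carrier (M l j)" if "i \<le> l" "l \<le> k" "k \<le> j" for l k
    using that ij B C by (intro product_entry) auto
  have gc: "g l k \<in> carrier (M i j)" if "i \<le> l" "k \<le> j" for l k
    unfolding g_def using that ij AB[of l k] T_entry[OF C, of k j]
    by (auto intro: \<mu>_closed[of i k j])
  have "(A \<otimes>\<^bsub>T\<^esub> B \<otimes>\<^bsub>T\<^esub> C) (i, j) = (\<Oplus>\<^bsub>M i j\<^esub>k\<in>{i..j}. \<Oplus>\<^bsub>M i j\<^esub>l\<in>{i..j}. g l k)"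
    unfolding mult_entry[OF ij]
  proof (rule finsum_cong')
    fix k assume "k \<in> {i..j}"
    then have k: "i \<le> k" "k \<le> j" by auto
    have "\<mu> i k j ((A \<otimes>\<^bsub>T\<^esub> B) (i, k)) (C (k, j))
      = (\<Oplus>\<^bsub>M i j\<^esub>l\<in>{i..k}. \<mu> i k j (\<mu> i l k (A (i, l)) (B (l, k))) (C (k, j)))"
      using k ij AB T_entry[OF C] by (simp add: mult_entry) (intro \<mu>_finsum_left, auto)
    also have "\<dots> = (\<Oplus>\<^bsub>M i j\<^esub>l\<in>{i..j}. g l k)"
      by (rule add.finprod_mono_neutral_cong_left)
        (use k gc[of _ k] in \<open>auto simp: g_def\<close>)
    finally show "\<mu> i k j ((A \<otimes>\<^bsub>T\<^esub> B) (i, k)) (C (k, j)) = (\<Oplus>\<^bsub>M i j\<^esub>l\<in>{i..j}. g l k)" .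
  qed (use gc in \<open>auto intro!: finsum_closed\<close>)
  also have "\<dots> = (\<Oplus>\<^bsub>M i j\<^esub>l\<in>{i..j}. \<Oplus>\<^bsub>M i j\<^esub>k\<in>{i..j}. g l k)"
    using gc by (intro add.finprod_finprod_swap) auto
  also have "\<dots> = (\<Oplus>\<^bsub>M i j\<^esub>l\<in>{i..j}. \<mu> i l j (A (i, l)) ((B \<otimes>\<^bsub>T\<^esub> C) (l, j)))"
  proof (rule finsum_cong')
    fix l assume "l \<in> {i..j}"
    then have l: "i \<le> l" "l \<le> j" by auto
    have "\<mu> i l j (A (i, l)) ((B \<otimes>\<^bsub>T\<^esub> C) (l, j))
      = (\<Oplus>\<^bsub>M i j\<^esub>k\<in>{l..j}. \<mu> i l j (A (i, l)) (\<mu> l k j (B (l, k)) (C (k, j))))"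
      using l ij BC T_entry[OF A] by (simp add: mult_entry) (intro \<mu>_finsum_right, auto)
    also have "\<dots> = (\<Oplus>\<^bsub>M i j\<^esub>k\<in>{i..j}. g l k)"
    proof (rule add.finprod_mono_neutral_cong_left)
      fix k assume "k \<in> {l..j}"
      then show "\<mu> i l j (A (i, l)) (\<mu> l k j (B (l, k)) (C (k, j))) = g l k"
        using l ij associative[of i l k j] T_entry A B C by (auto simp: g_def)
    qed (use l gc in \<open>auto simp: g_def\<close>)
    finally show "(\<Oplus>\<^bsub>M i j\<^esub>k\<in>{i..j}. g l k) = \<mu> i l j (A (i, l)) ((B \<otimes>\<^bsub>T\<^esub> C) (l, j))" ..
  qed (use ij T_entry A T_mult_closed[OF B C] in \<open>auto intro!: \<mu>_closed\<close>)
  also have "\<dots> = (A \<otimes>\<^bsub>T\<^esub> (B \<otimes>\<^bsub>T\<^esub> C)) (i, j)"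
    by (simp add: mult_entry[OF ij])
  finally show "(A \<otimes>\<^bsub>T\<^esub> B \<otimes>\<^bsub>T\<^esub> C) (i, j) = (A \<otimes>\<^bsub>T\<^esub> (B \<otimes>\<^bsub>T\<^esub> C)) (i, j)" .
qed (auto intro: T_mult_closed A B C)

sublocale T: rng T
proof (intro rng.intro rng_axioms.intro)
  fix A B C assume A: "A \<in> carrier T" and B: "B \<in> carrier T"
  show "A \<otimes>\<^bsub>T\<^esub> B \<in> carrier T" using A B by (rule T_mult_closed)
  assume C: "C \<in> carrier T"
  show "A \<otimes>\<^bsub>T\<^esub> B \<otimes>\<^bsub>T\<^esub> C = A \<otimes>\<^bsub>T\<^esub> (B \<otimes>\<^bsub>T\<^esub> C)" using A B C by (rule T_mult_assoc)
  show "(A \<oplus>\<^bsub>T\<^esub> B) \<otimes>\<^bsub>T\<^esub> C = A \<otimes>\<^bsub>T\<^esub> C \<oplus>\<^bsub>T\<^esub> B \<otimes>\<^bsub>T\<^esub> C"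
  proof (rule T_ext)
    fix i j assume ij: "index i j"
    interpret abelian_group "M i j" using ij by (rule M_abelian_group)
    have "((A \<oplus>\<^bsub>T\<^esub> B) \<otimes>\<^bsub>T\<^esub> C) (i, j) =
      (\<Oplus>\<^bsub>M i j\<^esub>k\<in>{i..j}. \<mu> i k j (A (i, k)) (C (k, j)) \<oplus>\<^bsub>M i j\<^esub> \<mu> i k j (B (i, k)) (C (k, j)))"
      unfolding mult_entry[OF ij]
      by (rule finsum_cong')
        (use ij A B C T_entry product_entry in \<open>auto simp: simp_implies_def add_entry \<mu>_add_left\<close>)
    also have "\<dots> = (A \<otimes>\<^bsub>T\<^esub> C \<oplus>\<^bsub>T\<^esub> B \<otimes>\<^bsub>T\<^esub> C) (i, j)"
      using ij product_entry A B C by (simp add: add_entry mult_entry finsum_addf)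
    finally show "((A \<oplus>\<^bsub>T\<^esub> B) \<otimes>\<^bsub>T\<^esub> C) (i, j) = (A \<otimes>\<^bsub>T\<^esub> C \<oplus>\<^bsub>T\<^esub> B \<otimes>\<^bsub>T\<^esub> C) (i, j)" .
  qed (auto intro: T_mult_closed T_add_closed A B C)
  show "C \<otimes>\<^bsub>T\<^esub> (A \<oplus>\<^bsub>T\<^esub> B) = C \<otimes>\<^bsub>T\<^esub> A \<oplus>\<^bsub>T\<^esub> C \<otimes>\<^bsub>T\<^esub> B"
  proof (rule T_ext)
    fix i j assume ij: "index i j"
    interpret abelian_group "M i j" using ij by (rule M_abelian_group)
    have "(C \<otimes>\<^bsub>T\<^esub> (A \<oplus>\<^bsub>T\<^esub> B)) (i, j) =
      (\<Oplus>\<^bsub>M i j\<^esub>k\<in>{i..j}. \<mu> i k j (C (i, k)) (A (k, j)) \<oplus>\<^bsub>M i j\<^esub> \<mu> i k j (C (i, k)) (B (k, j)))"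
      unfolding mult_entry[OF ij]
      by (rule finsum_cong')
        (use ij A B C T_entry product_entry in \<open>auto simp: simp_implies_def add_entry \<mu>_add_right\<close>)
    also have "\<dots> = (C \<otimes>\<^bsub>T\<^esub> A \<oplus>\<^bsub>T\<^esub> C \<otimes>\<^bsub>T\<^esub> B) (i, j)"
      using ij product_entry A B C by (simp add: add_entry mult_entry finsum_addf)
    finally show "(C \<otimes>\<^bsub>T\<^esub> (A \<oplus>\<^bsub>T\<^esub> B)) (i, j) = (C \<otimes>\<^bsub>T\<^esub> A \<oplus>\<^bsub>T\<^esub> C \<otimes>\<^bsub>T\<^esub> B) (i, j)" .
  qed (auto intro: T_mult_closed T_add_closed A B C)
qed (rule T_abelian_group)

section \<open>Matrices with a single nonzero entry\<close>

definition emb :: "nat \<Rightarrow> nat \<Rightarrow> 'a \<Rightarrow> nat \<times> nat \<Rightarrow> 'a" where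
  "emb i j a = (\<lambda>(k, l)\<in>upper_indices n. if (k, l) = (i, j) then a else \<zero>\<^bsub>M k l\<^esub>)"

lemma M_zero_closed: "index i j \<Longrightarrow> \<zero>\<^bsub>M i j\<^esub> \<in> carrier (M i j)"
  using M_abelian_group abelian_group.axioms(1) abelian_monoid.zero_closed by blast

text \<open>No index condition is imposed: for a pair that is not an index pair,
  \<open>emb i j a\<close> is the zero matrix.\<close>

lemma emb_closed: "a \<in> carrier (M i j) \<Longrightarrow> emb i j a \<in> carrier T"
  unfolding emb_def by (rule T_restrictI) (auto intro: M_zero_closed)

lemma emb_entry: "index k l \<Longrightarrow> emb i j a (k, l) = (if (k, l) = (i, j) then a else \<zero>\<^bsub>M k l\<^esub>)"
  by (simp add: emb_def upper_indices_def)

lemma emb_zero: "emb i j \<zero>\<^bsub>M i j\<^esub> = \<zero>\<^bsub>T\<^esub>"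
  unfolding emb_def by (auto simp: triangular_matrices_def intro!: restrict_ext)

lemma emb_zero_iff: "index i j \<Longrightarrow> emb i j a = \<zero>\<^bsub>T\<^esub> \<longleftrightarrow> a = \<zero>\<^bsub>M i j\<^esub>"
  using emb_zero emb_entry[of i j i j a] zero_entry[of i j] by auto

lemma mult_entry_single:
  assumes "A \<in> carrier T" "B \<in> carrier T" "index i j" "i \<le> k" "k \<le> j"
    and "\<And>l. \<lbrakk>i \<le> l; l \<le> j; l \<noteq> k\<rbrakk> \<Longrightarrow> A (i, l) = \<zero>\<^bsub>M i l\<^esub> \<or> B (l, j) = \<zero>\<^bsub>M l j\<^esub>"
  shows "(A \<otimes>\<^bsub>T\<^esub> B) (i, j) = \<mu> i k j (A (i, k)) (B (k, j))"
proof -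
  interpret abelian_group "M i j" using assms by (intro M_abelian_group)
  have "(A \<otimes>\<^bsub>T\<^esub> B) (i, j)
    = (\<Oplus>\<^bsub>M i j\<^esub>l\<in>{i..j}. if k = l then \<mu> i l j (A (i, l)) (B (l, j)) else \<zero>\<^bsub>M i j\<^esub>)"
    unfolding mult_entry[OF assms(3)]
  proof (rule finsum_cong')
    show "(\<lambda>l. if k = l then \<mu> i l j (A (i, l)) (B (l, j)) else \<zero>\<^bsub>M i j\<^esub>) \<in> {i..j} \<rightarrow> carrier (M i j)"
      using product_entry[OF assms(1-3)] by auto
    fix l assume "l \<in> {i..j}"
    then show "\<mu> i l j (A (i, l)) (B (l, j)) = (if k = l then \<mu> i l j (A (i, l)) (B (l, j)) else \<zero>\<^bsub>M i j\<^esub>)"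
      using assms(6)[of l] assms(3) T_entry[OF assms(1), of i l] T_entry[OF assms(2), of l j]
      by (auto simp: \<mu>_zero_left \<mu>_zero_right)
  qed simp
  also have "\<dots> = \<mu> i k j (A (i, k)) (B (k, j))"
    using assms product_entry[OF assms(1-3)] by (intro finsum_singleton) auto
  finally show ?thesis .
qed

lemma mult_entry_zero:
  assumes "A \<in> carrier T" "B \<in> carrier T" "index i j"
    and "\<And>l. \<lbrakk>i \<le> l; l \<le> j\<rbrakk> \<Longrightarrow> A (i, l) = \<zero>\<^bsub>M i l\<^esub> \<or> B (l, j) = \<zero>\<^bsub>M l j\<^esub>"
  shows "(A \<otimes>\<^bsub>T\<^esub> B) (i, j) = \<zero>\<^bsub>M i j\<^esub>"
  using mult_entry_single[OF assms(1-3), of i] assms(4)[of i] assms(3,4)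
    T_entry[OF assms(1), of i i] T_entry[OF assms(2), of i j]
    \<mu>_zero_left[of i i j "B (i, j)"] \<mu>_zero_right[of i i j "A (i, i)"]
  by auto

lemma emb_mult_entry:
  assumes "index i j" "a \<in> carrier (M i j)" "B \<in> carrier T" "index k l"
  shows "(emb i j a \<otimes>\<^bsub>T\<^esub> B) (k, l) = (if k = i \<and> j \<le> l then \<mu> i j l a (B (j, l)) else \<zero>\<^bsub>M k l\<^esub>)"
proof (cases "k = i \<and> j \<le> l")
  case True
  have "(emb i j a \<otimes>\<^bsub>T\<^esub> B) (k, l) = \<mu> k j l (emb i j a (k, j)) (B (j, l))"
    using True assms by (intro mult_entry_single emb_closed) (auto simp: emb_entry)
  with True assms show ?thesis by (simp add: emb_entry)
next
  case False
  have "(emb i j a \<otimes>\<^bsub>T\<^esub> B) (k, l) = \<zero>\<^bsub>M k l\<^esub>"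
    using False assms by (intro mult_entry_zero emb_closed) (auto simp: emb_entry)
  with False show ?thesis by auto
qed

lemma mult_emb_entry:
  assumes "index i j" "a \<in> carrier (M i j)" "B \<in> carrier T" "index k l"
  shows "(B \<otimes>\<^bsub>T\<^esub> emb i j a) (k, l) = (if l = j \<and> k \<le> i then \<mu> k i j (B (k, i)) a else \<zero>\<^bsub>M k l\<^esub>)"
proof (cases "l = j \<and> k \<le> i")
  case True
  have "(B \<otimes>\<^bsub>T\<^esub> emb i j a) (k, l) = \<mu> k i l (B (k, i)) (emb i j a (i, l))"
    using True assms by (intro mult_entry_single emb_closed) (auto simp: emb_entry)
  with True assms show ?thesis by (simp add: emb_entry)
next
  case False
  have "(B \<otimes>\<^bsub>T\<^esub> emb i j a) (k, l) = \<zero>\<^bsub>M k l\<^esub>"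
    using False assms by (intro mult_entry_zero emb_closed) (auto simp: emb_entry)
  with False show ?thesis by auto
qed

lemma emb_mult_emb:
  assumes "index i j" "index j k" "a \<in> carrier (M i j)" "b \<in> carrier (M j k)"
  shows "emb i j a \<otimes>\<^bsub>T\<^esub> emb j k b = emb i k (\<mu> i j k a b)"
proof (rule T_ext)
  fix p q assume pq: "index p q"
  show "(emb i j a \<otimes>\<^bsub>T\<^esub> emb j k b) (p, q) = emb i k (\<mu> i j k a b) (p, q)"
    using assms pq emb_closed[OF assms(4)]
    by (auto simp: emb_mult_entry emb_entry \<mu>_zero_right)
qed (use assms in \<open>auto intro!: emb_closed \<mu>_closed T_mult_closed\<close>)

lemma emb_mult_emb_orth:
  assumes "index i j" "index k l" "a \<in> carrier (M i j)" "b \<in> carrier (M k l)" "j \<noteq> k"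
  shows "emb i j a \<otimes>\<^bsub>T\<^esub> emb k l b = \<zero>\<^bsub>T\<^esub>"
proof (rule T_ext)
  fix p q assume pq: "index p q"
  show "(emb i j a \<otimes>\<^bsub>T\<^esub> emb k l b) (p, q) = \<zero>\<^bsub>T\<^esub> (p, q)"
    using assms pq emb_closed[OF assms(4)]
    by (auto simp: emb_mult_entry emb_entry \<mu>_zero_right zero_entry)
qed (use assms in \<open>auto intro!: emb_closed T_mult_closed T_zero_closed\<close>)

text \<open>The left factor retains only row i and the right factor only column j, so just the entry
  X_ij survives, acted on from both sides.\<close>

lemma emb_corner:
  assumes ij: "index i j" and a: "a \<in> carrier (R i)" and b: "b \<in> carrier (R j)" and X: "X \<in> carrier T"
  shows "emb i i a \<otimes>\<^bsub>T\<^esub> X \<otimes>\<^bsub>T\<^esub> emb j j b = emb i j (ract (M i j) (lact (M i j) a (X (i, j))) b)"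
proof (rule T_ext)
  have a': "a \<in> carrier (M i i)" and b': "b \<in> carrier (M j j)" and ii: "index i i" and jj: "index j j"
    using ij a b by auto
  have Xij: "X (i, j) \<in> carrier (M i j)" using X ij by (rule T_entry)
  have 1: "\<mu> i i j a (X (i, j)) = lact (M i j) a (X (i, j))"
    using ij a Xij by (intro canonical_left) auto
  have c1: "lact (M i j) a (X (i, j)) \<in> carrier (M i j)"
    using \<mu>_closed[of i i j] ij a' Xij by (simp flip: 1)
  have 2: "\<mu> i j j (lact (M i j) a (X (i, j))) b = ract (M i j) (lact (M i j) a (X (i, j))) b"
    using ij b c1 by (intro canonical_right) auto
  have c2: "ract (M i j) (lact (M i j) a (X (i, j))) b \<in> carrier (M i j)"
    using \<mu>_closed[of i j j] ij b' c1 by (simp flip: 2)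
  show "emb i j (ract (M i j) (lact (M i j) a (X (i, j))) b) \<in> carrier T"
    using c2 by (rule emb_closed)
  have aX: "emb i i a \<otimes>\<^bsub>T\<^esub> X \<in> carrier T" using a' X emb_closed T_mult_closed by blast
  then show "emb i i a \<otimes>\<^bsub>T\<^esub> X \<otimes>\<^bsub>T\<^esub> emb j j b \<in> carrier T" using b' emb_closed T_mult_closed by blast
  fix p q assume pq: "index p q"
  show "(emb i i a \<otimes>\<^bsub>T\<^esub> X \<otimes>\<^bsub>T\<^esub> emb j j b) (p, q)
      = emb i j (ract (M i j) (lact (M i j) a (X (i, j))) b) (p, q)"
  proof (cases "q = j \<and> p \<le> j")
    case True
    then show ?thesis
      using mult_emb_entry[OF jj b' aX pq] emb_mult_entry[OF ii a' X, of p j] ij pq b'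
      by (auto simp: emb_entry 1 2 \<mu>_zero_left)
  next
    case False
    then show ?thesis
      using mult_emb_entry[OF jj b' aX pq] ij pq by (auto simp: emb_entry)
  qed
qed

text \<open>The product could only be nonzero at (j, i), which lies below the diagonal.\<close>

lemma emb_lower_corner:
  assumes "1 \<le> i" "i < j" "j \<le> n" and a: "a \<in> carrier (R i)" and b: "b \<in> carrier (R j)"
    and X: "X \<in> carrier T"
  shows "emb j j b \<otimes>\<^bsub>T\<^esub> X \<otimes>\<^bsub>T\<^esub> emb i i a = \<zero>\<^bsub>T\<^esub>"
proof (rule T_ext)
  have a': "a \<in> carrier (M i i)" and b': "b \<in> carrier (M j j)" and ii: "index i i" and jj: "index j j"
    using assms by auto
  have bX: "emb j j b \<otimes>\<^bsub>T\<^esub> X \<in> carrier T" using b' X emb_closed T_mult_closed by blast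
  then show "emb j j b \<otimes>\<^bsub>T\<^esub> X \<otimes>\<^bsub>T\<^esub> emb i i a \<in> carrier T" using a' emb_closed T_mult_closed by blast
  fix p q assume pq: "index p q"
  show "(emb j j b \<otimes>\<^bsub>T\<^esub> X \<otimes>\<^bsub>T\<^esub> emb i i a) (p, q) = \<zero>\<^bsub>T\<^esub> (p, q)"
    using mult_emb_entry[OF ii a' bX pq] emb_mult_entry[OF jj b' X, of p i] assms pq a'
    by (auto simp: zero_entry \<mu>_zero_left)
qed (rule T_zero_closed)

text \<open>Negation in T is given by the group structure and not entrywise. The entry of the
  difference is recovered from A = (A - B) + B, where \<open>add_entry\<close> applies.\<close>

lemma minus_entry:
  assumes "A \<in> carrier T" "B \<in> carrier T" "index i j"
  shows "(A \<ominus>\<^bsub>T\<^esub> B) (i, j) = A (i, j) \<ominus>\<^bsub>M i j\<^esub> B (i, j)"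
proof -
  interpret abelian_group "M i j" using assms by (intro M_abelian_group)
  have "A = (A \<ominus>\<^bsub>T\<^esub> B) \<oplus>\<^bsub>T\<^esub> B"
    using assms by (simp add: a_minus_def T.a_assoc T.l_neg)
  then have "A (i, j) = (A \<ominus>\<^bsub>T\<^esub> B) (i, j) \<oplus>\<^bsub>M i j\<^esub> B (i, j)"
    using add_entry assms(3) by metis
  then show ?thesis
    using T_entry[OF _ assms(3)] assms by (simp add: a_minus_def a_assoc r_neg)
qed

lemma emb_diff:
  assumes "index i j" "a \<in> carrier (M i j)" "b \<in> carrier (M i j)"
  shows "emb i j a \<ominus>\<^bsub>T\<^esub> emb i j b = emb i j (a \<ominus>\<^bsub>M i j\<^esub> b)"
proof (rule T_ext)
  interpret abelian_group "M i j" using assms by (intro M_abelian_group)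
  show "emb i j (a \<ominus>\<^bsub>M i j\<^esub> b) \<in> carrier T" using assms by (intro emb_closed) auto
  fix p q assume pq: "index p q"
  interpret pq: abelian_group "M p q" using pq by (rule M_abelian_group)
  show "(emb i j a \<ominus>\<^bsub>T\<^esub> emb i j b) (p, q) = emb i j (a \<ominus>\<^bsub>M i j\<^esub> b) (p, q)"
    using assms pq by (simp add: minus_entry emb_closed emb_entry) (simp add: a_minus_def)
qed (use assms emb_closed in auto)

section \<open>The centre of the matrix ring and its Peirce decomposition\<close>

lemma entry_zeroI:
  assumes "1 \<le> i" "i < j" "j \<le> n" "X \<in> carrier T"
    and "\<And>a b. \<lbrakk>a \<in> carrier (R i); b \<in> carrier (R j)\<rbrakk>
      \<Longrightarrow> emb i i a \<otimes>\<^bsub>T\<^esub> X \<otimes>\<^bsub>T\<^esub> emb j j b = \<zero>\<^bsub>T\<^esub>"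
  shows "X (i, j) = \<zero>\<^bsub>M i j\<^esub>"
  using assms T_entry[of X i j] emb_corner[of i j _ _ X]
  by (intro nondegenerate) (auto simp: emb_zero_iff)

text \<open>With x = X_ii and y = X_jj, the relation x m = m y gives x (r m) = (r m) y = r (m y) = r
  (x m). Thus x r - r x annihilates M_ij and is zero by faithfulness. The argument for y is the
  mirror image.\<close>

lemma diagonal_central:
  assumes X: "X \<in> carrier T" and "1 \<le> i" "i < j" "j \<le> n"
    and comm: "\<And>m. m \<in> carrier (M i j) \<Longrightarrow> lact (M i j) (X (i, i)) m = ract (M i j) m (X (j, j))"
  shows "r \<in> carrier (R i) \<Longrightarrow> X (i, i) \<otimes>\<^bsub>R i\<^esub> r = r \<otimes>\<^bsub>R i\<^esub> X (i, i)"
    and "s \<in> carrier (R j) \<Longrightarrow> X (j, j) \<otimes>\<^bsub>R j\<^esub> s = s \<otimes>\<^bsub>R j\<^esub> X (j, j)"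
proof -
  interpret bimodule "R i" "R j" "M i j" using assms by (intro bimodules) auto
  have x: "X (i, i) \<in> carrier (R i)" and y: "X (j, j) \<in> carrier (R j)"
    using T_entry[OF X, of i i] T_entry[OF X, of j j] assms by auto
  show "X (i, i) \<otimes>\<^bsub>R i\<^esub> r = r \<otimes>\<^bsub>R i\<^esub> X (i, i)" if r: "r \<in> carrier (R i)"
  proof -
    let ?d = "X (i, i) \<otimes>\<^bsub>R i\<^esub> r \<ominus>\<^bsub>R i\<^esub> r \<otimes>\<^bsub>R i\<^esub> X (i, i)"
    have "lact (M i j) ?d m = \<zero>\<^bsub>M i j\<^esub>" if m: "m \<in> carrier (M i j)" for m
    proof -
      \<comment> \<open>The action is axiomatised as additive, so the difference enters as a
        summand, which is cancelled afterwards.\<close>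
      have "X (i, i) \<otimes>\<^bsub>R i\<^esub> r = r \<otimes>\<^bsub>R i\<^esub> X (i, i) \<oplus>\<^bsub>R i\<^esub> ?d"
        using x r by (simp add: a_minus_def R.a_lcomm[of _ "X (i, i) \<otimes>\<^bsub>R i\<^esub> r"] R.r_neg)
      then have "lact (M i j) (X (i, i) \<otimes>\<^bsub>R i\<^esub> r) m
        = lact (M i j) (r \<otimes>\<^bsub>R i\<^esub> X (i, i)) m \<oplus>\<^bsub>M i j\<^esub> lact (M i j) ?d m"
        using x r m by (metis lact_add_left R.m_closed R.minus_closed)
      moreover have "lact (M i j) (X (i, i) \<otimes>\<^bsub>R i\<^esub> r) m = lact (M i j) (r \<otimes>\<^bsub>R i\<^esub> X (i, i)) m"
        using x r y m by (simp add: lact_assoc comm lact_closed lact_ract)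
      ultimately show ?thesis
        using x r m by (simp add: lact_closed)
    qed
    then have "?d = \<zero>\<^bsub>R i\<^esub>"
      using faithful[of i j] assms x r unfolding faithful_left_def by simp
    then show ?thesis using x r by (simp add: R.diff_eq_zero_iff)
  qed
  show "X (j, j) \<otimes>\<^bsub>R j\<^esub> s = s \<otimes>\<^bsub>R j\<^esub> X (j, j)" if s: "s \<in> carrier (R j)"
  proof -
    let ?d = "X (j, j) \<otimes>\<^bsub>R j\<^esub> s \<ominus>\<^bsub>R j\<^esub> s \<otimes>\<^bsub>R j\<^esub> X (j, j)"
    have "ract (M i j) m ?d = \<zero>\<^bsub>M i j\<^esub>" if m: "m \<in> carrier (M i j)" for m
    proof -
      have "X (j, j) \<otimes>\<^bsub>R j\<^esub> s = s \<otimes>\<^bsub>R j\<^esub> X (j, j) \<oplus>\<^bsub>R j\<^esub> ?d"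
        using y s by (simp add: a_minus_def S.a_lcomm[of _ "X (j, j) \<otimes>\<^bsub>R j\<^esub> s"] S.r_neg)
      then have "ract (M i j) m (X (j, j) \<otimes>\<^bsub>R j\<^esub> s)
        = ract (M i j) m (s \<otimes>\<^bsub>R j\<^esub> X (j, j)) \<oplus>\<^bsub>M i j\<^esub> ract (M i j) m ?d"
        using y s m by (metis ract_add_right S.m_closed S.minus_closed)
      moreover have "ract (M i j) m (X (j, j) \<otimes>\<^bsub>R j\<^esub> s) = ract (M i j) m (s \<otimes>\<^bsub>R j\<^esub> X (j, j))"
        using x s y m by (simp add: ract_assoc ract_closed lact_ract flip: comm)
      ultimately show ?thesis
        using y s m by (simp add: ract_closed)
    qed
    then have "?d = \<zero>\<^bsub>R j\<^esub>"
      using faithful[of i j] assms y s unfolding faithful_right_def by simp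
    then show ?thesis using y s by (simp add: S.diff_eq_zero_iff)
  qed
qed

lemma T_centralI:
  assumes n: "2 \<le> n" and X: "X \<in> carrier T"
    and off: "\<And>i j. \<lbrakk>1 \<le> i; i < j; j \<le> n\<rbrakk> \<Longrightarrow> X (i, j) = \<zero>\<^bsub>M i j\<^esub>"
    and comm: "\<And>i j m. \<lbrakk>1 \<le> i; i < j; j \<le> n; m \<in> carrier (M i j)\<rbrakk>
      \<Longrightarrow> lact (M i j) (X (i, i)) m = ract (M i j) m (X (j, j))"
  shows "X \<in> ring_center T"
proof -
  have "X \<otimes>\<^bsub>T\<^esub> Y = Y \<otimes>\<^bsub>T\<^esub> X" if Y: "Y \<in> carrier T" for Y
  proof (rule T_ext)
    fix i j assume ij: "index i j"
    have XY: "(X \<otimes>\<^bsub>T\<^esub> Y) (i, j) = \<mu> i i j (X (i, i)) (Y (i, j))"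
      using ij X Y off by (intro mult_entry_single) auto
    have YX: "(Y \<otimes>\<^bsub>T\<^esub> X) (i, j) = \<mu> i j j (Y (i, j)) (X (j, j))"
      using ij X Y off by (intro mult_entry_single) auto
    have Yij: "Y (i, j) \<in> carrier (M i j)" using Y ij by (rule T_entry)
    have x: "X (i, i) \<in> carrier (R i)" "X (j, j) \<in> carrier (R j)"
      using T_entry[OF X, of i i] T_entry[OF X, of j j] ij by auto
    show "(X \<otimes>\<^bsub>T\<^esub> Y) (i, j) = (Y \<otimes>\<^bsub>T\<^esub> X) (i, j)"
    proof (cases "i < j")
      case True
      then show ?thesis
        unfolding XY YX using ij x Yij comm by (simp add: canonical_left canonical_right)
    next
      case False
      then have j: "j = i" using ij by simp
      \<comment> \<open>A diagonal entry is central in R_i through any off-diagonal partner: the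
        pair (i, n) when i < n, and (1, n) when i = n. The latter is off the diagonal because n is
        at least 2.\<close>
      have "X (i, i) \<otimes>\<^bsub>R i\<^esub> Y (i, i) = Y (i, i) \<otimes>\<^bsub>R i\<^esub> X (i, i)"
      proof (cases "i < n")
        case True
        then show ?thesis
          using diagonal_central(1)[OF X, of i n] comm[of i n] ij Yij j by simp
      next
        case False
        then show ?thesis
          using diagonal_central(2)[OF X, of 1 i] comm[of 1 i] ij Yij j n by simp
      qed
      then show ?thesis
        unfolding XY YX using ij x Yij j by (simp add: canonical_left)
    qed
  qed (use X Y T_mult_closed in auto)
  then show ?thesis using X by (simp add: ring_center_def)
qed

text \<open>The index condition inside \<open>?E\<close> lets all natural numbers serve as indices,
  since membership supplies the bounds. The bound on n enters through
  \<open>T_centralI\<close>.\<close>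

lemma T_peirce_rng:
  assumes n: "2 \<le> n"
  shows "peirce_rng T (\<lambda>i j. {emb i j x |x. index i j \<and> x \<in> carrier (M i j)})"
    (is "peirce_rng T ?E")
proof (intro peirce_rng.intro peirce_rng_axioms.intro)
  show "rng T" by (rule T.rng_axioms)
next
  fix x i j assume "x \<in> ?E i j"
  then show "x \<in> carrier T" using emb_closed by blast
next
  fix x y i j assume "x \<in> ?E i j" "y \<in> ?E i j"
  then obtain a b where ab: "index i j" "a \<in> carrier (M i j)" "b \<in> carrier (M i j)"
    "x = emb i j a" "y = emb i j b" by blast
  interpret abelian_group "M i j" using ab by (intro M_abelian_group)
  have "a \<ominus>\<^bsub>M i j\<^esub> b \<in> carrier (M i j)" using ab by simp
  then show "x \<ominus>\<^bsub>T\<^esub> y \<in> ?E i j" using ab emb_diff by blast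
next
  fix x y i j k assume "x \<in> ?E i j" "y \<in> ?E j k"
  then obtain a b where ab: "index i j" "index j k" "a \<in> carrier (M i j)" "b \<in> carrier (M j k)"
    "x = emb i j a" "y = emb j k b" by blast
  then have "\<mu> i j k a b \<in> carrier (M i k)" "index i k" by (auto intro: \<mu>_closed)
  then show "x \<otimes>\<^bsub>T\<^esub> y \<in> ?E i k" using ab emb_mult_emb by auto
next
  fix x y i j k l assume "x \<in> ?E i j" "y \<in> ?E k l" "j \<noteq> k"
  then show "x \<otimes>\<^bsub>T\<^esub> y = \<zero>\<^bsub>T\<^esub>" using emb_mult_emb_orth by blast
next
  fix a b X i j assume "a \<in> ?E i i" "b \<in> ?E j j" "i < j" and X: "X \<in> carrier T"
  then obtain r s where rs: "index i j" "r \<in> carrier (R i)" "s \<in> carrier (R j)"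
    "a = emb i i r" "b = emb j j s" by auto
  interpret bimodule "R i" "R j" "M i j" using rs by (intro bimodules) auto
  have "ract (M i j) (lact (M i j) r (X (i, j))) s \<in> carrier (M i j)"
    using rs T_entry[OF X] by (intro ract_closed lact_closed) auto
  then show "a \<otimes>\<^bsub>T\<^esub> X \<otimes>\<^bsub>T\<^esub> b \<in> ?E i j" using rs X emb_corner by auto
next
  fix a b X i j assume "a \<in> ?E i i" "b \<in> ?E j j" "i < j" "X \<in> carrier T"
  then show "b \<otimes>\<^bsub>T\<^esub> X \<otimes>\<^bsub>T\<^esub> a = \<zero>\<^bsub>T\<^esub>" using emb_lower_corner by auto
next
  fix x i j assume x: "x \<in> ?E i j" and ij: "i < j"
    and 0: "\<And>a b. \<lbrakk>a \<in> ?E i i; b \<in> ?E j j\<rbrakk> \<Longrightarrow> a \<otimes>\<^bsub>T\<^esub> x \<otimes>\<^bsub>T\<^esub> b = \<zero>\<^bsub>T\<^esub>"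
  then obtain m where m: "index i j" "m \<in> carrier (M i j)" "x = emb i j m" by blast
  have "emb i i a \<otimes>\<^bsub>T\<^esub> x \<otimes>\<^bsub>T\<^esub> emb j j b = \<zero>\<^bsub>T\<^esub>" if "a \<in> carrier (R i)" "b \<in> carrier (R j)" for a b
    using that m by (intro 0) auto
  then have "x (i, j) = \<zero>\<^bsub>M i j\<^esub>" using m ij emb_closed by (intro entry_zeroI) auto
  then show "x = \<zero>\<^bsub>T\<^esub>" using m by (simp add: emb_entry emb_zero)
next
  fix X assume X: "X \<in> carrier T"
    and 1: "\<And>i j a b. \<lbrakk>i < j; a \<in> ?E i i; b \<in> ?E j j\<rbrakk> \<Longrightarrow> a \<otimes>\<^bsub>T\<^esub> X \<otimes>\<^bsub>T\<^esub> b = \<zero>\<^bsub>T\<^esub>"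
    and 2: "\<And>i j a b m. \<lbrakk>i < j; a \<in> ?E i i; b \<in> ?E j j; m \<in> ?E i j\<rbrakk>
      \<Longrightarrow> a \<otimes>\<^bsub>T\<^esub> lie_bracket T m X \<otimes>\<^bsub>T\<^esub> b = \<zero>\<^bsub>T\<^esub>"
  show "X \<in> ring_center T"
  proof (rule T_centralI[OF n X])
    fix i j assume ij: "1 \<le> i" "i < j" "j \<le> n"
    show "X (i, j) = \<zero>\<^bsub>M i j\<^esub>"
      using ij X by (intro entry_zeroI 1) auto
    fix m assume m: "m \<in> carrier (M i j)"
    interpret abelian_group "M i j" using ij by (intro M_abelian_group) auto
    have xs: "X (i, i) \<in> carrier (R i)" "X (j, j) \<in> carrier (R j)"
      using T_entry[OF X, of i i] T_entry[OF X, of j j] ij by auto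
    have mT: "emb i j m \<in> carrier T" using m by (rule emb_closed)
    then have brT: "lie_bracket T (emb i j m) X \<in> carrier T" using X by simp
    have "lie_bracket T (emb i j m) X (i, j) = \<zero>\<^bsub>M i j\<^esub>"
      using ij m brT by (intro entry_zeroI 2) auto
    \<comment> \<open>At (i, j), left multiplication by the single entry m yields m X_jj, and right
      multiplication yields X_ii m. Vanishing of this entry is the commutation relation required by
      \<open>T_centralI\<close>.\<close>
    moreover have "lie_bracket T (emb i j m) X (i, j)
      = ract (M i j) m (X (j, j)) \<ominus>\<^bsub>M i j\<^esub> lact (M i j) (X (i, i)) m"
      using ij m mT X xs
      by (simp add: lie_bracket_def minus_entry emb_mult_entry mult_emb_entry canonical_left canonical_right)
    moreover have "ract (M i j) m (X (j, j)) \<in> carrier (M i j)" "lact (M i j) (X (i, i)) m \<in> carrier (M i j)"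
      using ij m xs bimodule.ract_closed[OF bimodules] bimodule.lact_closed[OF bimodules] by auto
    ultimately show "lact (M i j) (X (i, i)) m = ract (M i j) m (X (j, j))"
      by (simp add: a_minus_def) (metis a_inv_closed minus_equality minus_minus a_comm)
  qed
qed

end

text \<open>The value of one n-fold bracket becomes the first argument of the next. Since p_n has d
  = n - 1 entries after the first, k rounds handle lists of length \<open>k * d\<close>.\<close>

lemma iterated_hom:
  assumes "rng R" "lie_multiplicative (Suc d) R S \<phi>"
  shows "\<lbrakk>x \<in> carrier R; set ys \<subseteq> carrier R; length ys = k * d\<rbrakk>
    \<Longrightarrow> \<phi> (foldl (lie_bracket R) x ys) = foldl (lie_bracket S) (\<phi> x) (map \<phi> ys)"
proof (induction k arbitrary: x ys)
  case (Suc k)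
  interpret rng R by fact
  let ?t = "take d ys" and ?u = "drop d ys"
  have sub: "set ?t \<subseteq> carrier R" "set ?u \<subseteq> carrier R"
    using Suc.prems(2) set_take_subset set_drop_subset by fast+
  have "foldl (lie_bracket R) x ys = iter (iter x ?t) ?u"
    by (metis append_take_drop_id foldl_append)
  also have "\<phi> \<dots> = foldl (lie_bracket S) (\<phi> (iter x ?t)) (map \<phi> ?u)"
    using Suc.prems sub by (intro Suc.IH) auto
  also have "\<phi> (iter x ?t) = foldl (lie_bracket S) (\<phi> x) (map \<phi> ?t)"
    using Suc.prems sub by (intro foldl_lie_bracket_hom[OF assms(2)]) auto
  finally show ?case
    by (metis append_take_drop_id foldl_append map_append)
qed simp

theorem theorem4p1:
  fixes n :: nat
    and R :: "nat \<Rightarrow> 'a ring"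
    and M :: "nat \<Rightarrow> nat \<Rightarrow> ('a, 'a, 'a) bimodule"
    and \<mu> :: "nat \<Rightarrow> nat \<Rightarrow> nat \<Rightarrow> 'a \<Rightarrow> 'a \<Rightarrow> 'a"
    and T :: "(nat \<times> nat \<Rightarrow> 'a) ring"
    and S :: "('b, 'x) ring_scheme"
    and \<phi> :: "(nat \<times> nat \<Rightarrow> 'a) \<Rightarrow> 'b"
  assumes "n \<ge> 2"
    and "triangular_matrix_ring n R M \<mu>"
    and "T = triangular_matrices n M \<mu>"
    and "rng S"
    and "bij_betw \<phi> (carrier T) (carrier S)"
    and "lie_multiplicative n T S \<phi>"
    and "\<phi> ` ring_center T \<subseteq> ring_center S"
  shows "\<forall>A\<in>carrier T. \<forall>B\<in>carrier T. \<exists>Z\<in>ring_center S.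
           \<phi> (A \<oplus>\<^bsub>T\<^esub> B) = \<phi> A \<oplus>\<^bsub>S\<^esub> \<phi> B \<oplus>\<^bsub>S\<^esub> Z"
proof -
  interpret tri: triangular_matrix_ring n R M \<mu> by fact
  let ?E = "\<lambda>i j. {tri.emb i j x |x. (1 \<le> i \<and> i \<le> j \<and> j \<le> n) \<and> x \<in> carrier (M i j)}"
  have P: "peirce_rng T ?E"
    using tri.T_peirce_rng assms(1,3) by simp
  then have "rng T" by (rule peirce_rng.axioms(1))
  have n: "n = Suc (n - 1)" using assms(1) by simp
  \<comment> \<open>Three rounds of the n-fold bracket give q = 3 (n - 1), which is at least 3 even
    for n = 2.\<close>
  interpret peirce_lie_iso T ?E S \<phi> "3 * (n - 1)"
  proof (intro peirce_lie_iso.intro peirce_lie_iso_axioms.intro P assms)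
    show "3 \<le> 3 * (n - 1)" using assms(1) by simp
    show "\<phi> (foldl (lie_bracket T) x ys) = foldl (lie_bracket S) (\<phi> x) (map \<phi> ys)"
      if "x \<in> carrier T" "set ys \<subseteq> carrier T" "length ys = 3 * (n - 1)" for x ys
      using iterated_hom[OF \<open>rng T\<close> _ that] assms(6) n by metis
  qed
  show ?thesis using almost_additive by blast
qed

end
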